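(* Let $p$ be a prime and let $A$ be a Henselian valuation ring which is not a field, with field of fractions $K$, maximal ideal $\mathfrak{m}_A$, residue field $k$ and valuation $v_A$, where $\operatorname{char}K=0$ and $\operatorname{char}k=p$. Assume $K$ contains a primitive $p$-th root of unity $\zeta$; put $\mathfrak{z}=\zeta-1$ and $e'=v_A(p)/(p-1)=v_A(\mathfrak{z})$. Let $L/K$ be a non-trivial Kummer extension of degree $p$. The following are equivalent: (a) A best $h$ for $L/K$ exists. (b) There exists $h\in A$ generating $L/K$ that satisfies exactly one of the following properties, where $s,t\in\mathfrak{m}_A$, $u,c\in A^\times$ and the residue class $\bar u$ of $u$ is not in $k^p$: (i) $p\nmid v_A(h)$; (ii) $h=u$; (iii) $h=1+ct$ with $0<v_A(t)<e'p$ and $p\nmid v_A(t)$; (iv) $h=1+us^p$ with $0<v_A(s)<e'$; (v) $h=1+c\mathfrak{z}^p$ with $\bar c\notin\{x^p-x\mid x\in k\}$. (c) The extension $L/K$ is defectless.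
   Context: An element $h\in K$ generates $L/K$ if $L=K(\alpha)$ with $\alpha^p=h$. If $h,h'$ both generate $L/K$ then $h'=h^ig^p$ for some $g\in K^\times$ and $1\le i\le p-1$. A generator $h$ is called best if $v_A(h-1)=\sup_{g\in K^\times,\,1\le i\le p-1}v_A(h^ig^p-1)$ (equivalently $v_A(\mathfrak{z}^p/(h-1))=\inf_{g,i}v_A(\mathfrak{z}^p/(h^ig^p-1))$). Since $A$ is Henselian, $v_A$ extends uniquely to $L$, with value group $\Gamma_B$ and residue field $l$; with $e_{L/K}=[\Gamma_B:v_A(K^\times)]$ and $f_{L/K}=[l:k]$, the defect $d_{L/K}$ is defined by $[L:K]=d_{L/K}e_{L/K}f_{L/K}$, and $L/K$ is defectless if $d_{L/K}=1$. *)

theory Defs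
  imports "HOL-Computational_Algebra.Polynomial"
begin

definition is_subfield :: "'a::field set \<Rightarrow> bool" where
  "is_subfield F \<longleftrightarrow> 0 \<in> F \<and> 1 \<in> F \<and>
     (\<forall>x\<in>F. \<forall>y\<in>F. x + y \<in> F \<and> x * y \<in> F) \<and>
     (\<forall>x\<in>F. - x \<in> F \<and> inverse x \<in> F)"

definition gen_field :: "'a::field set \<Rightarrow> 'a \<Rightarrow> 'a set" where
  "gen_field K \<alpha> = \<Inter>{F. is_subfield F \<and> K \<subseteq> F \<and> \<alpha> \<in> F}"

definition lin_indep_over :: "'a::field set \<Rightarrow> 'a set \<Rightarrow> bool" where
  "lin_indep_over K B \<longleftrightarrow> (\<forall>F c. finite F \<and> F \<subseteq> B \<and> (\<forall>b\<in>F. c b \<in> K) \<and>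
      (\<Sum>b\<in>F. c b * b) = 0 \<longrightarrow> (\<forall>b\<in>F. c b = 0))"

definition span_over :: "'a::field set \<Rightarrow> 'a set \<Rightarrow> 'a set" where
  "span_over K B = {(\<Sum>b\<in>F. c b * b) | F c. finite F \<and> F \<subseteq> B \<and> (\<forall>b\<in>F. c b \<in> K)}"

definition is_finite_basis :: "'a::field set \<Rightarrow> 'a set \<Rightarrow> 'a set \<Rightarrow> bool" where
  "is_finite_basis K V B \<longleftrightarrow> finite B \<and> B \<subseteq> V \<and> lin_indep_over K B \<and> span_over K B = V"

definition ext_degree :: "'a::field set \<Rightarrow> 'a set \<Rightarrow> nat" where
  "ext_degree K V = (if \<exists>B. is_finite_basis K V B
      then card (SOME B. is_finite_basis K V B) else 0)"

text \<open>A (Krull) valuation on the whole field type 'a with values in an ordered abelian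
  group; the value at 0 (infinity) is not represented and never used.\<close>
definition valuation :: "('a::field \<Rightarrow> 'g::linordered_ab_group_add) \<Rightarrow> bool" where
  "valuation w \<longleftrightarrow>
     (\<forall>x y. x \<noteq> 0 \<longrightarrow> y \<noteq> 0 \<longrightarrow> w (x * y) = w x + w y) \<and>
     (\<forall>x y. x \<noteq> 0 \<longrightarrow> y \<noteq> 0 \<longrightarrow> x + y \<noteq> 0 \<longrightarrow> min (w x) (w y) \<le> w (x + y))"

definition val_ring :: "('a::field \<Rightarrow> 'g::linordered_ab_group_add) \<Rightarrow> 'a set \<Rightarrow> 'a set" where
  "val_ring w K = {x \<in> K. x = 0 \<or> 0 \<le> w x}"

definition max_ideal :: "('a::field \<Rightarrow> 'g::linordered_ab_group_add) \<Rightarrow> 'a set \<Rightarrow> 'a set" where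
  "max_ideal w K = {x \<in> K. x = 0 \<or> 0 < w x}"

definition val_units :: "('a::field \<Rightarrow> 'g::linordered_ab_group_add) \<Rightarrow> 'a set \<Rightarrow> 'a set" where
  "val_units w K = {x \<in> K. x \<noteq> 0 \<and> w x = 0}"

definition henselian :: "('a::field \<Rightarrow> 'g::linordered_ab_group_add) \<Rightarrow> 'a set \<Rightarrow> bool" where
  "henselian w K \<longleftrightarrow> (\<forall>f a. (\<forall>i. coeff f i \<in> val_ring w K) \<and> lead_coeff f = 1 \<and>
      a \<in> val_ring w K \<and> poly f a \<in> max_ideal w K \<and> poly (pderiv f) a \<in> val_units w K
      \<longrightarrow> (\<exists>b \<in> val_ring w K. poly f b = 0 \<and> b - a \<in> max_ideal w K))"

definition value_group :: "('a::field \<Rightarrow> 'g::linordered_ab_group_add) \<Rightarrow> 'a set \<Rightarrow> 'g set" where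
  "value_group w K = w ` (K - {0})"

definition ram_index :: "('a::field \<Rightarrow> 'g::linordered_ab_group_add) \<Rightarrow> 'a set \<Rightarrow> nat" where
  "ram_index w K = card {((+) g) ` value_group w K | g. g \<in> value_group w UNIV}"

text \<open>Residue degree [l:k]: maximal number of elements of O_B whose residues in l are
  linearly independent over k (this is dim_k l written out on representatives).\<close>
definition res_indep :: "('a::field \<Rightarrow> 'g::linordered_ab_group_add) \<Rightarrow> 'a set \<Rightarrow> 'a set \<Rightarrow> bool" where
  "res_indep w K F \<longleftrightarrow> F \<subseteq> val_ring w UNIV \<and>
     (\<forall>c. (\<forall>b\<in>F. c b \<in> val_ring w K) \<and> (\<Sum>b\<in>F. c b * b) \<in> max_ideal w UNIV
        \<longrightarrow> (\<forall>b\<in>F. c b \<in> max_ideal w K))"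

definition res_degree :: "('a::field \<Rightarrow> 'g::linordered_ab_group_add) \<Rightarrow> 'a set \<Rightarrow> nat" where
  "res_degree w K = Sup {card F | F. finite F \<and> res_indep w K F}"

definition defectless :: "('a::field \<Rightarrow> 'g::linordered_ab_group_add) \<Rightarrow> 'a set \<Rightarrow> bool" where
  "defectless w K \<longleftrightarrow> ext_degree K UNIV = ram_index w K * res_degree w K"

definition generates :: "'a::field set \<Rightarrow> nat \<Rightarrow> 'a \<Rightarrow> bool" where
  "generates K p h \<longleftrightarrow> h \<in> K \<and> (\<exists>\<alpha>. \<alpha> ^ p = h \<and> gen_field K \<alpha> = UNIV)"

definition best_gen :: "('a::field \<Rightarrow> 'g::linordered_ab_group_add) \<Rightarrow> 'a set \<Rightarrow> nat \<Rightarrow> 'a \<Rightarrow> bool" where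
  "best_gen w K p h \<longleftrightarrow> generates K p h \<and>
     (\<forall>g\<in>K - {0}. \<forall>i\<in>{1..p-1}. w (h ^ i * g ^ p - 1) \<le> w (h - 1))"

definition not_p_div_val :: "('a::field \<Rightarrow> 'g::linordered_ab_group_add) \<Rightarrow> 'a set \<Rightarrow> nat \<Rightarrow> 'a \<Rightarrow> bool" where
  "not_p_div_val w K p x \<longleftrightarrow> \<not> (\<exists>y\<in>K - {0}. w x = w (y ^ p))"

definition res_not_pth_power :: "('a::field \<Rightarrow> 'g::linordered_ab_group_add) \<Rightarrow> 'a set \<Rightarrow> nat \<Rightarrow> 'a \<Rightarrow> bool" where
  "res_not_pth_power w K p u \<longleftrightarrow> \<not> (\<exists>x\<in>val_ring w K. u - x ^ p \<in> max_ideal w K)"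

definition res_not_AS :: "('a::field \<Rightarrow> 'g::linordered_ab_group_add) \<Rightarrow> 'a set \<Rightarrow> nat \<Rightarrow> 'a \<Rightarrow> bool" where
  "res_not_AS w K p c \<longleftrightarrow> \<not> (\<exists>x\<in>val_ring w K. c - (x ^ p - x) \<in> max_ideal w K)"

definition prop_i where
  "prop_i w K p h \<longleftrightarrow> not_p_div_val w K p h"

definition prop_ii where
  "prop_ii w K p h \<longleftrightarrow> (\<exists>u\<in>val_units w K. res_not_pth_power w K p u \<and> h = u)"

definition prop_iii where
  "prop_iii w K p z h \<longleftrightarrow> (\<exists>c\<in>val_units w K. \<exists>t\<in>max_ideal w K. t \<noteq> 0 \<and>
      h = 1 + c * t \<and> 0 < w t \<and> w t < w (z ^ p) \<and> not_p_div_val w K p t)"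

definition prop_iv where
  "prop_iv w K p z h \<longleftrightarrow> (\<exists>u\<in>val_units w K. \<exists>s\<in>max_ideal w K. s \<noteq> 0 \<and>
      res_not_pth_power w K p u \<and> h = 1 + u * s ^ p \<and> 0 < w s \<and> w s < w z)"

definition prop_v where
  "prop_v w K p z h \<longleftrightarrow> (\<exists>c\<in>val_units w K. res_not_AS w K p c \<and> h = 1 + c * z ^ p)"

definition exactly_one :: "bool list \<Rightarrow> bool" where
  "exactly_one bs \<longleftrightarrow> length (filter id bs) = 1"

end

theory Submission
  imports Defs "HOL-Number_Theory.Cong"
begin

text \<open>
  Write \<open>\<O>\<close>, \<open>\<M>\<close>, \<open>\<U>\<close> for the valuation ring of \<open>L\<close>, its maximal ideal and its units, and put
  \<open>z = \<zeta> - 1\<close>. For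
  \<open>b \<in> \<M>\<close> one has \<open>(1 + b)\<^sup>p = 1 + b\<^sup>p + z\<^bsup>p-1\<^esup> b e\<close> with \<open>e \<equiv> -1\<close>. So the leading term of
  \<open>(1 + b)\<^sup>p - 1\<close> is \<open>b\<^sup>p\<close> if \<open>w b < w z\<close>, and for \<open>b = z d\<close> it is \<open>z\<^sup>p (d\<^sup>p - d)\<close>. This decides whether
  \<open>w (h - 1)\<close> can be raised by a factor \<open>g\<^sup>p\<close>, which is impossible exactly in the cases (i)-(v);
  if \<open>w (h - 1) > p w z\<close>, then \<open>h\<close> is a \<open>p\<close>-th power by Hensel's lemma.

  In the cases (i) and (iii), \<open>\<alpha>\<close> resp. \<open>\<alpha> - 1\<close> has a value outside that of \<open>K\<close>, so \<open>e = p\<close>. In the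
  others a quotient \<open>\<beta> = (\<alpha> - a) / s\<close> is integral with residue of degree \<open>p\<close>, so \<open>f = p\<close>. Conversely,
  if \<open>e f = p\<close>, then \<open>L\<close> has a valuation-independent basis, hence \<open>\<alpha>\<close> has a best approximation in
  \<open>K\<close>. After normalising it to \<open>1\<close>, \<open>w (h - 1)\<close> cannot be raised.
\<close>

section \<open>Valued fields and linear algebra over a subfield\<close>

text \<open>The threshold is \<open>w z\<close> because the terms \<open>b ^ p\<close> and
  \<open>p * b\<close> of \<open>(1 + b) ^ p - 1\<close> have equal value exactly when (p - 1) w b =
  w p. Below it the leading term is governed by the Frobenius map of the residue field, which is why
  (iv) asks that u is no p-th power; at it, by the Artin-Schreier map, which is why (v) has its
  form. The value of 0 carries no meaning, so inequalities between values are mostly expressed by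
  membership of a quotient in \<O>, \<M> or \<U>, and statements on residues are congruences modulo
  \<M>; the residue field itself is never formed. Defect concerns L as a vector space over K and
  does not mention h. The link is the root: multiplying h by \<open>c ^ p\<close> multiplies
  \<alpha> by c, so a better generator amounts to a better approximation of \<alpha> by
  \<open>1 / c\<close>. For f = p, irreducibility of X^p - u and of X^p - X - c over k is not
  treated case by case. In both situations the conjugates of \<beta> differ from \<beta> by elements
  of K modulo \<M>, and one argument on a coefficient suffices.\<close>

locale valued_field =
  fixes w :: "'a::field \<Rightarrow> 'g::linordered_ab_group_add"
  assumes val: "valuation w"
begin

abbreviation OO ("\<O>") where "\<O> \<equiv> val_ring w UNIV"
abbreviation MM ("\<M>") where "\<M> \<equiv> max_ideal w UNIV"

lemma O_iff: "x \<in> \<O> \<longleftrightarrow> x = 0 \<or> 0 \<le> w x"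
  by (simp add: val_ring_def)

lemma M_iff: "x \<in> \<M> \<longleftrightarrow> x = 0 \<or> 0 < w x"
  by (simp add: max_ideal_def)

lemma w_mult: "x \<noteq> 0 \<Longrightarrow> y \<noteq> 0 \<Longrightarrow> w (x * y) = w x + w y"
  using val by (simp add: valuation_def)

lemma w_add: "x \<noteq> 0 \<Longrightarrow> y \<noteq> 0 \<Longrightarrow> x + y \<noteq> 0 \<Longrightarrow> min (w x) (w y) \<le> w (x + y)"
  using val by (simp add: valuation_def)

lemma w_1 [simp]: "w 1 = 0"
  using w_mult[of 1 1] by simp

lemma w_minus [simp]: "w (- x) = w x"
proof -
  have "w (-1) + w (-1) = 0"
    using w_mult[of "-1" "-1"] by simp
  then have "w (-1) = 0"
    by (simp add: double_zero)
  then show ?thesis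
    using w_mult[of "-1" x] by (cases "x = 0") auto
qed

lemma w_inverse: "x \<noteq> 0 \<Longrightarrow> w (inverse x) = - w x"
  using w_mult[of x "inverse x"] by (simp add: eq_neg_iff_add_eq_0 add.commute)

lemma w_divide: "x \<noteq> 0 \<Longrightarrow> y \<noteq> 0 \<Longrightarrow> w (x / y) = w x - w y"
  using w_mult[of x "inverse y"] by (simp add: w_inverse divide_inverse)

lemma M_sub_O: "x \<in> \<M> \<Longrightarrow> x \<in> \<O>"
  by (auto simp: O_iff M_iff)

lemma O_0 [simp]: "0 \<in> \<O>" and O_1 [simp]: "1 \<in> \<O>"
  and M_0 [simp]: "0 \<in> \<M>" and M_1 [simp]: "1 \<notin> \<M>"
  by (auto simp: O_iff M_iff)

lemma O_add: "x \<in> \<O> \<Longrightarrow> y \<in> \<O> \<Longrightarrow> x + y \<in> \<O>"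
  using w_add[of x y] by (cases "x = 0"; cases "y = 0"; cases "x + y = 0")
    (auto simp: O_iff min_def split: if_splits intro: order_trans)

lemma M_add: "x \<in> \<M> \<Longrightarrow> y \<in> \<M> \<Longrightarrow> x + y \<in> \<M>"
  using w_add[of x y] by (cases "x = 0"; cases "y = 0"; cases "x + y = 0")
    (auto simp: M_iff min_def split: if_splits)

lemma O_minus: "- x \<in> \<O> \<longleftrightarrow> x \<in> \<O>"
  by (auto simp: O_iff)

lemma M_minus: "- x \<in> \<M> \<longleftrightarrow> x \<in> \<M>"
  by (auto simp: M_iff)

lemma O_diff: "x \<in> \<O> \<Longrightarrow> y \<in> \<O> \<Longrightarrow> x - y \<in> \<O>"
  using O_add[of x "- y"] by (simp add: O_minus)

lemma M_diff: "x \<in> \<M> \<Longrightarrow> y \<in> \<M> \<Longrightarrow> x - y \<in> \<M>"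
  using M_add[of x "- y"] by (simp add: M_minus)

lemma O_mult: "x \<in> \<O> \<Longrightarrow> y \<in> \<O> \<Longrightarrow> x * y \<in> \<O>"
  using w_mult[of x y] by (cases "x = 0"; cases "y = 0") (auto simp: O_iff)

lemma M_mult: "x \<in> \<M> \<Longrightarrow> y \<in> \<O> \<Longrightarrow> x * y \<in> \<M>"
  using w_mult[of x y] by (cases "x = 0"; cases "y = 0") (auto simp: O_iff M_iff add_pos_nonneg)

lemma M_mult': "x \<in> \<O> \<Longrightarrow> y \<in> \<M> \<Longrightarrow> x * y \<in> \<M>"
  using M_mult[of y x] by (simp add: mult.commute)

lemma O_power: "x \<in> \<O> \<Longrightarrow> x ^ n \<in> \<O>"
  by (induction n) (auto simp: O_mult)

lemma M_power: "x \<in> \<M> \<Longrightarrow> n > 0 \<Longrightarrow> x ^ n \<in> \<M>"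
  by (cases n) (auto simp: M_mult O_power M_sub_O)

lemma O_sum: "(\<And>i. i \<in> I \<Longrightarrow> f i \<in> \<O>) \<Longrightarrow> sum f I \<in> \<O>"
  by (induction I rule: infinite_finite_induct) (auto intro: O_add)

lemma M_sum: "(\<And>i. i \<in> I \<Longrightarrow> f i \<in> \<M>) \<Longrightarrow> sum f I \<in> \<M>"
  by (induction I rule: infinite_finite_induct) (auto intro: M_add)

lemma O_of_nat: "of_nat n \<in> \<O>"
  by (induction n) (auto intro: O_add)

lemma not_O: "x \<notin> \<O> \<Longrightarrow> x \<noteq> 0 \<and> inverse x \<in> \<M>"
  by (auto simp: O_iff M_iff w_inverse)

lemma not_M: "x \<notin> \<M> \<Longrightarrow> x \<noteq> 0 \<and> inverse x \<in> \<O>"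
  by (auto simp: O_iff M_iff w_inverse)

lemma inverse_M: "x \<noteq> 0 \<Longrightarrow> inverse x \<in> \<O> \<longleftrightarrow> x \<notin> \<M>"
  by (auto simp: O_iff M_iff w_inverse)

lemma inverse_O: "x \<noteq> 0 \<Longrightarrow> inverse x \<in> \<M> \<longleftrightarrow> x \<notin> \<O>"
  by (auto simp: O_iff M_iff w_inverse)

lemma M_prime: "x \<notin> \<M> \<Longrightarrow> y \<notin> \<M> \<Longrightarrow> x * y \<notin> \<M>"
  using not_M[of x] not_M[of y] O_mult[of "inverse x" "inverse y"] inverse_M[of "x * y"] by auto

lemma M_power_iff: "n > 0 \<Longrightarrow> x ^ n \<in> \<M> \<longleftrightarrow> x \<in> \<M>"
proof
  show "x ^ n \<in> \<M> \<Longrightarrow> x \<in> \<M>"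
    by (induction n) (use M_prime in auto)
qed (rule M_power)

lemma O_power_iff: "n > 0 \<Longrightarrow> x ^ n \<in> \<O> \<longleftrightarrow> x \<in> \<O>"
  using M_power_iff[of n "inverse x"] inverse_O[of x] inverse_O[of "x ^ n"]
  by (cases "x = 0") (auto simp: power_inverse zero_power)

definition unit_O ("\<U>") where "\<U> = \<O> - \<M>"

lemma U_iff: "x \<in> \<U> \<longleftrightarrow> x \<noteq> 0 \<and> w x = 0"
  by (auto simp: unit_O_def O_iff M_iff)

lemma U_O: "x \<in> \<U> \<Longrightarrow> x \<in> \<O>" and U_not_M: "x \<in> \<U> \<Longrightarrow> x \<notin> \<M>"
  and U_not_0: "x \<in> \<U> \<Longrightarrow> x \<noteq> 0"
  by (auto simp: unit_O_def)

lemma U_1 [simp]: "1 \<in> \<U>"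
  by (simp add: U_iff)

lemma U_mult: "x \<in> \<U> \<Longrightarrow> y \<in> \<U> \<Longrightarrow> x * y \<in> \<U>"
  by (auto simp: U_iff w_mult)

lemma U_inverse: "x \<in> \<U> \<Longrightarrow> inverse x \<in> \<U>"
  by (auto simp: U_iff w_inverse)

lemma U_divide: "x \<in> \<U> \<Longrightarrow> y \<in> \<U> \<Longrightarrow> x / y \<in> \<U>"
  by (auto simp: U_iff w_divide)

lemma U_minus: "- x \<in> \<U> \<longleftrightarrow> x \<in> \<U>"
  by (auto simp: U_iff)

lemma U_power: "x \<in> \<U> \<Longrightarrow> x ^ n \<in> \<U>"
  by (induction n) (auto simp: U_mult)

lemma U_power_iff: "n > 0 \<Longrightarrow> x ^ n \<in> \<U> \<longleftrightarrow> x \<in> \<U>"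
  by (simp add: unit_O_def M_power_iff O_power_iff)

lemma U_cong: "x \<in> \<U> \<Longrightarrow> y - x \<in> \<M> \<Longrightarrow> y \<in> \<U>"
  unfolding unit_O_def
  using O_add[of "y - x" x] M_diff[of y "y - x"] by (auto intro: M_sub_O)

lemma M_cong: "y - x \<in> \<M> \<Longrightarrow> y \<in> \<M> \<longleftrightarrow> x \<in> \<M>"
  using M_add[of "y - x" x] M_diff[of y "y - x"] by auto

lemma w_less_iff: "x \<noteq> 0 \<Longrightarrow> y \<noteq> 0 \<Longrightarrow> w x < w y \<longleftrightarrow> y / x \<in> \<M>"
  by (auto simp: M_iff w_divide)

lemma w_le_iff: "x \<noteq> 0 \<Longrightarrow> y \<noteq> 0 \<Longrightarrow> w x \<le> w y \<longleftrightarrow> y / x \<in> \<O>"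
  by (auto simp: O_iff w_divide)

lemma w_eq_iff: "x \<noteq> 0 \<Longrightarrow> y \<noteq> 0 \<Longrightarrow> w x = w y \<longleftrightarrow> y / x \<in> \<U>"
  by (auto simp: U_iff w_divide)

text \<open>The set 1 + a\<M> is closed under multiplication; this allows changing the exponent of a
  generator without losing the bound on its distance from 1.\<close>

lemma one_M_power: 
  assumes "m \<in> \<M>" "a \<in> \<O>"
  shows "\<exists>m'\<in>\<M>. (1 + a * m) ^ j = 1 + a * m'"
proof (induction j)
  case (Suc j)
  then obtain m' where m': "m' \<in> \<M>" "(1 + a * m) ^ j = 1 + a * m'" by auto
  have "(1 + a * m) ^ Suc j = 1 + a * (m + m' + a * m * m')"
    by (simp add: m' algebra_simps)
  moreover have "m + m' + a * m * m' \<in> \<M>"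
    using m' assms by (intro M_add M_mult[OF M_mult'] M_sub_O[of m']) auto
  ultimately show ?case by blast
qed (auto intro: bexI[of _ 0])

text \<open>After division by the term of least value all other terms lie in \<M>, so the quotient
  is 1 plus an element of \<M>, a unit.\<close>

lemma w_sum_distinct:
  assumes "finite I" "\<And>i. i \<in> I \<Longrightarrow> s i \<noteq> 0" "inj_on (\<lambda>i. w (s i)) I" "i \<in> I"
  shows "sum s I \<noteq> 0 \<and> w (sum s I) \<le> w (s i)"
proof -
  obtain k where k: "k \<in> I" "\<And>i. i \<in> I \<Longrightarrow> w (s k) \<le> w (s i)"
    using arg_min_if_finite[of I "\<lambda>i. w (s i)"] assms by (metis empty_iff not_le)
  have "(\<Sum>i\<in>I - {k}. s i / s k) \<in> \<M>"
  proof (rule M_sum)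
    fix i assume i: "i \<in> I - {k}"
    then have "w (s k) \<noteq> w (s i)"
      using assms(3) k(1) by (auto dest: inj_onD)
    then have "w (s k) < w (s i)" using k(2)[of i] i by auto
    then show "s i / s k \<in> \<M>" using assms(2) k i by (subst (asm) w_less_iff) auto
  qed
  moreover have "sum s I / s k = 1 + (\<Sum>i\<in>I - {k}. s i / s k)"
    using k assms by (simp add: sum.remove sum_divide_distrib add_divide_distrib)
  ultimately have "sum s I / s k \<in> \<U>"
    using U_cong[of 1 "sum s I / s k"] by simp
  then have "sum s I \<noteq> 0" "w (s k) = w (sum s I)"
    using U_not_0 k assms by (force, subst w_eq_iff) (auto simp: U_iff)
  then show ?thesis using k(2)[OF assms(4)] by simp
qed

end

locale valued_subfield = valued_field w
  for w :: "'a::field \<Rightarrow> 'g::linordered_ab_group_add" +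
  fixes K :: "'a set"
  assumes subK: "is_subfield K"
begin

lemma K_0 [simp]: "0 \<in> K" and K_1 [simp]: "1 \<in> K"
  and K_add: "x \<in> K \<Longrightarrow> y \<in> K \<Longrightarrow> x + y \<in> K"
  and K_mult: "x \<in> K \<Longrightarrow> y \<in> K \<Longrightarrow> x * y \<in> K"
  and K_minus: "x \<in> K \<Longrightarrow> - x \<in> K"
  and K_inverse: "x \<in> K \<Longrightarrow> inverse x \<in> K"
  using subK by (auto simp: is_subfield_def)

lemma K_diff: "x \<in> K \<Longrightarrow> y \<in> K \<Longrightarrow> x - y \<in> K"
  using K_add[of x "- y"] K_minus by simp

lemma K_divide: "x \<in> K \<Longrightarrow> y \<in> K \<Longrightarrow> x / y \<in> K"
  using K_mult[of x "inverse y"] K_inverse by (simp add: divide_inverse)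

lemma K_power: "x \<in> K \<Longrightarrow> x ^ n \<in> K"
  by (induction n) (auto simp: K_mult)

lemma K_sum: "(\<And>i. i \<in> I \<Longrightarrow> f i \<in> K) \<Longrightarrow> sum f I \<in> K"
  by (induction I rule: infinite_finite_induct) (auto intro: K_add)

lemma K_of_nat: "of_nat n \<in> K"
  by (induction n) (auto intro: K_add)

lemmas K_closed = K_add K_mult K_minus K_inverse K_diff K_divide K_power K_sum K_of_nat

lemma val_ring_K: "x \<in> val_ring w K \<longleftrightarrow> x \<in> K \<and> x \<in> \<O>"
  by (auto simp: val_ring_def)

lemma max_ideal_K: "x \<in> max_ideal w K \<longleftrightarrow> x \<in> K \<and> x \<in> \<M>"
  by (auto simp: max_ideal_def)

lemma val_units_K: "x \<in> val_units w K \<longleftrightarrow> x \<in> K \<and> x \<in> \<U>"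
  by (auto simp: val_units_def U_iff)

section \<open>Linear algebra over K\<close>

lemma homogeneous_system:
  assumes "finite I" "finite J" "card I < card J" "\<And>i j. i \<in> I \<Longrightarrow> j \<in> J \<Longrightarrow> a i j \<in> K"
  shows "\<exists>x. (\<forall>j\<in>J. x j \<in> K) \<and> (\<exists>j\<in>J. x j \<noteq> 0) \<and> (\<forall>i\<in>I. (\<Sum>j\<in>J. a i j * x j) = 0)"
  using assms
proof (induction I arbitrary: J a rule: finite_induct)
  case empty
  then obtain j where "j \<in> J" by fastforce
  then show ?case by (intro exI[of _ "\<lambda>_. 1"]) auto
next
  case (insert i I)
  show ?case
  proof (cases "\<forall>j\<in>J. a i j = 0")
    case True
    have "card I < card J" using insert by auto
    then obtain x where "\<forall>j\<in>J. x j \<in> K" "\<exists>j\<in>J. x j \<noteq> 0" "\<forall>i\<in>I. (\<Sum>j\<in>J. a i j * x j) = 0"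
      using insert.IH[of J a] insert.prems by auto
    then show ?thesis using True by (intro exI[of _ x]) auto
  next
    case False
    then obtain k where k: "k \<in> J" "a i k \<noteq> 0" by auto
    define J' where "J' = J - {k}"
    \<comment> \<open>Gaussian elimination: equation \<open>i\<close> with pivot
      \<open>a i k\<close> removes the unknown \<open>k\<close> from the other equations. The value
      of that unknown is restored in \<open>y\<close>.\<close>
    define b where "b = (\<lambda>l j. a l j - a l k * a i j / a i k)"
    have J': "finite J'" "card I < card J'" "k \<notin> J'" "J = insert k J'"
      using insert.prems insert.hyps k by (auto simp: J'_def)
    have "\<And>l j. l \<in> I \<Longrightarrow> j \<in> J' \<Longrightarrow> b l j \<in> K"
      unfolding b_def using insert.prems J' by (intro K_closed) auto
    then obtain x where x: "\<forall>j\<in>J'. x j \<in> K" "\<exists>j\<in>J'. x j \<noteq> 0"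
      "\<forall>l\<in>I. (\<Sum>j\<in>J'. b l j * x j) = 0"
      using insert.IH[of J' b] J' by blast
    define s where "s = (\<Sum>j\<in>J'. a i j * x j)"
    define y where "y = x(k := - s / a i k)"
    have yJ: "(\<Sum>j\<in>J'. c j * y j) = (\<Sum>j\<in>J'. c j * x j)" for c
      using J' by (intro sum.cong) (auto simp: y_def)
    have "s \<in> K" unfolding s_def using insert.prems x(1) J' by (intro K_closed) auto
    then have "\<forall>j\<in>J. y j \<in> K"
      using x insert.prems J' by (auto simp: y_def intro!: K_closed)
    moreover have "\<exists>j\<in>J. y j \<noteq> 0" using x J' by (auto simp: y_def)
    moreover have "(\<Sum>j\<in>J. a i j * y j) = 0"
      using J' k by (simp add: yJ s_def[symmetric]) (simp add: y_def)
    moreover have "(\<Sum>j\<in>J. a l j * y j) = 0" if "l \<in> I" for l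
    proof -
      have "0 = (\<Sum>j\<in>J'. a l j * x j) - (\<Sum>j\<in>J'. a l k / a i k * (a i j * x j))"
        using x(3) that by (simp add: b_def algebra_simps sum_subtractf)
      also have "\<dots> = (\<Sum>j\<in>J'. a l j * x j) - a l k / a i k * s"
        by (simp add: s_def sum_distrib_left)
      finally show ?thesis using J' by (simp add: yJ) (simp add: y_def)
    qed
    ultimately show ?thesis by (intro exI[of _ y]) auto
  qed
qed

text \<open>Stated for families, unlike \<open>lin_indep_over\<close>: a repeated vector counts as a
  dependence, so counting the products indexed by \<open>X \<times> F\<close> later requires no
  separate proof that they are distinct.\<close>

definition indep_fam where
  "indep_fam I b \<longleftrightarrow> (\<forall>c. (\<forall>i\<in>I. c i \<in> K) \<and> (\<Sum>i\<in>I. c i * b i) = 0 \<longrightarrow> (\<forall>i\<in>I. c i = 0))"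

text \<open>The coordinates of the \<open>y j\<close> in the basis form a homogeneous system with
  \<open>card B\<close> equations and \<open>card J\<close> unknowns.\<close>

lemma dependent_family:
  assumes "is_finite_basis K UNIV B" "finite J" "card B < card J"
  shows "\<not> indep_fam J y"
proof -
  have B: "finite B" using assms(1) by (simp add: is_finite_basis_def)
  have "\<exists>c. (\<forall>b\<in>B. c b \<in> K) \<and> v = (\<Sum>b\<in>B. c b * b)" for v
  proof -
    have "v \<in> span_over K B" using assms(1) by (simp add: is_finite_basis_def)
    then obtain F c where F: "finite F" "F \<subseteq> B" "\<forall>b\<in>F. c b \<in> K" "v = (\<Sum>b\<in>F. c b * b)"
      by (auto simp: span_over_def)
    have "(\<Sum>b\<in>B. (if b \<in> F then c b else 0) * b) = (\<Sum>b\<in>F. (if b \<in> F then c b else 0) * b)"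
      using B F by (intro sum.mono_neutral_right) auto
    also have "\<dots> = v" using F by simp
    finally show ?thesis using F by (intro exI[of _ "\<lambda>b. if b \<in> F then c b else 0"]) auto
  qed
  then obtain A where A: "\<And>v b. b \<in> B \<Longrightarrow> A v b \<in> K" "\<And>v. v = (\<Sum>b\<in>B. A v b * b)"
    by metis
  obtain x where x: "\<forall>j\<in>J. x j \<in> K" "\<exists>j\<in>J. x j \<noteq> 0"
    "\<forall>b\<in>B. (\<Sum>j\<in>J. A (y j) b * x j) = 0"
    using homogeneous_system[OF B assms(2,3), of "\<lambda>b j. A (y j) b"] A by auto
  have "(\<Sum>j\<in>J. x j * y j) = (\<Sum>j\<in>J. \<Sum>b\<in>B. A (y j) b * x j * b)"
    by (subst (1) A(2)) (simp add: sum_distrib_left mult_ac)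
  also have "\<dots> = (\<Sum>b\<in>B. (\<Sum>j\<in>J. A (y j) b * x j) * b)"
    by (subst sum.swap) (simp add: sum_distrib_right)
  also have "\<dots> = 0" using x by simp
  finally show ?thesis using x by (auto simp: indep_fam_def)
qed

lemma spanning_family:
  assumes "is_finite_basis K UNIV B" "finite I" "card I = card B" "indep_fam I y"
  shows "\<exists>c. (\<forall>i\<in>I. c i \<in> K) \<and> v = (\<Sum>i\<in>I. c i * y i)"
proof -
  \<comment> \<open>\<open>None\<close> indexes the additional vector \<open>v\<close>. The enlarged
    family is dependent, and independence of \<open>y\<close> forces the coefficient at
    \<open>None\<close> to be nonzero.\<close>
  let ?J = "insert None (Some ` I)"
  have "card B < card ?J" using assms(2,3) by (simp add: card_image)
  then obtain c where c: "\<forall>i\<in>?J. c i \<in> K" "(\<Sum>i\<in>?J. c i * case_option v y i) = 0" "\<exists>i\<in>?J. c i \<noteq> 0"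
    using dependent_family[OF assms(1), of ?J "case_option v y"] assms(2)
    unfolding indep_fam_def by auto
  have sum: "c None * v + (\<Sum>i\<in>I. c (Some i) * y i) = 0"
    using c(2) assms(2) by (simp add: sum.reindex)
  have "c None \<noteq> 0"
  proof
    assume 0: "c None = 0"
    then have "\<forall>i\<in>I. c (Some i) = 0"
      using sum assms(4)[unfolded indep_fam_def, rule_format, of "\<lambda>i. c (Some i)"] c(1) by auto
    then show False using c(3) 0 by auto
  qed
  then have "v = (\<Sum>i\<in>I. (- c (Some i) / c None) * y i)"
    using sum by (simp add: sum_negf sum_divide_distrib[symmetric] field_simps eq_neg_iff_add_eq_0 add.commute)
  then show ?thesis using c(1) by (intro exI[of _ "\<lambda>i. - c (Some i) / c None"]) (auto intro!: K_closed)
qed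

end

section \<open>Powers of one-units\<close>

locale kummer_field = valued_subfield w K
  for w :: "'a::field_char_0 \<Rightarrow> 'g::linordered_ab_group_add" and K :: "'a set" +
  fixes p :: nat and \<zeta> :: 'a
  assumes prime_p: "prime p"
    and hens: "henselian w K"
    and char_k: "0 < w (of_nat p :: 'a)"
    and zeta: "\<zeta> \<in> K" "\<zeta> ^ p = 1" "\<zeta> \<noteq> 1"
    and deg: "ext_degree K (UNIV :: 'a set) = p"
begin

lemma p_ge_2: "p \<ge> 2" and p_pos: "p > 0"
  using prime_p prime_ge_2_nat prime_gt_0_nat by auto

lemma p_M: "of_nat p \<in> \<M>"
  using char_k by (simp add: M_iff)

lemma inverse_mod_p:
  assumes "0 < j" "j < p"
  obtains i n where "j * i = 1 + p * n" "0 < i"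
proof -
  have "coprime j p"
    using assms prime_p by (metis coprime_commute nat_dvd_not_less prime_imp_coprime_nat)
  then obtain i where i: "[j * i = 1] (mod p)"
    using cong_solve_coprime_nat by auto
  then have "j * i \<noteq> 0"
    using p_ge_2 by (metis cong_0_1_nat cong_sym numeral_le_one_iff semiring_norm(69))
  then obtain n where "j * i = 1 + p * n"
    using i by (metis One_nat_def add.commute cong_le_nat less_one mult.commute not_less)
  moreover have "0 < i" using \<open>j * i \<noteq> 0\<close> by (cases i) auto
  ultimately show ?thesis using that by blast
qed

lemma of_nat_U:
  assumes "0 < j" "j < p"
  shows "of_nat j \<in> \<U>"
proof -
  obtain i n where "j * i = 1 + p * n" using inverse_mod_p[OF assms] by blast
  then have eq: "of_nat j * of_nat i - of_nat p * of_nat n = (1 :: 'a)"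
    by (metis add_diff_cancel_right' of_nat_1 of_nat_add of_nat_mult)
  have "of_nat j \<notin> \<M>"
  proof
    assume "of_nat j \<in> \<M>"
    then have "of_nat j * of_nat i - of_nat p * of_nat n \<in> \<M>"
      by (intro M_diff M_mult O_of_nat p_M)
    then show False by (simp add: eq)
  qed
  then show ?thesis by (simp add: unit_O_def O_of_nat)
qed

lemma of_nat_choose:
  assumes "0 < k" "k < p"
  shows "of_nat (p choose k) = (of_nat p * of_nat ((p choose k) div p) :: 'a)"
proof -
  have "p dvd p choose k" using assms prime_p by (intro dvd_choose_prime) auto
  then show ?thesis by (metis dvd_mult_div_cancel of_nat_mult)
qed

lemma frobenius_add:
  assumes "x \<in> \<O>" "y \<in> \<O>"
  shows "(x + y) ^ p - (x ^ p + y ^ p) \<in> \<M>"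
proof -
  have "(x + y) ^ p = (\<Sum>k\<in>insert 0 (insert p {1..<p}). of_nat (p choose k) * x ^ k * y ^ (p - k))"
    by (subst binomial_ring, rule sum.cong) (use p_ge_2 in auto)
  also have "\<dots> = y ^ p + x ^ p + (\<Sum>k\<in>{1..<p}. of_nat (p choose k) * x ^ k * y ^ (p - k))"
    using p_pos by simp
  finally have "(x + y) ^ p - (x ^ p + y ^ p) = (\<Sum>k\<in>{1..<p}. of_nat (p choose k) * x ^ k * y ^ (p - k))"
    by simp
  also have "\<dots> \<in> \<M>"
    using assms by (intro M_sum M_mult O_power) (auto simp: of_nat_choose intro: M_mult p_M O_of_nat)
  finally show ?thesis .
qed

text \<open>Modulo \<M> this is (-1)^p = -1, uniformly in p; for p = 2 it holds because -1 and 1 are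
  congruent.\<close>

lemma frobenius_minus: "x \<in> \<O> \<Longrightarrow> (- x) ^ p + x ^ p \<in> \<M>"
  using frobenius_add[of x "- x"] M_minus[of "(- x) ^ p + x ^ p"] p_pos
  by (simp add: O_minus zero_power algebra_simps)

lemma frobenius_diff:
  assumes "x \<in> \<O>" "y \<in> \<O>"
  shows "(x - y) ^ p - (x ^ p - y ^ p) \<in> \<M>"
  using M_add[OF frobenius_add[of x "- y"] frobenius_minus[of y]] assms
  by (simp add: O_minus algebra_simps)

lemma frobenius_inj:
  assumes "x \<in> \<O>" "y \<in> \<O>" "x ^ p - y ^ p \<in> \<M>"
  shows "x - y \<in> \<M>"
  using M_cong[OF frobenius_diff[OF assms(1,2)]] assms(3) M_power_iff[OF p_pos] by simp

text \<open>Frobenius is injective on the residue field, so 1 has no other p-th root there. Roots of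
  one-units are therefore of the form 1 + b with b in \<M>, to which the expansions below
  apply.\<close>

lemma power_p_near_1:
  assumes "x ^ p - 1 \<in> \<M>"
  shows "x - 1 \<in> \<M>"
proof -
  have "x ^ p \<in> \<U>" using assms U_cong[of 1] by simp
  then have "x \<in> \<O>" using U_O U_power_iff[OF p_pos] by blast
  then show ?thesis using assms frobenius_inj[of x 1] by simp
qed

text \<open>The middle binomial coefficients are divisible by p and, except for the linear one, come
  with at least \<open>b ^ 2\<close>; they are absorbed in \<open>m\<close>. The linear term must
  stay visible, since it competes with \<open>b ^ p\<close>.\<close>

lemma one_plus_power_p:
  assumes "b \<in> \<M>"
  shows "\<exists>m\<in>\<M>. (1 + b) ^ p = 1 + b ^ p + of_nat p * b * (1 + m)"
proof
  define m where "m = (\<Sum>k\<in>{2..<p}. of_nat ((p choose k) div p) * b ^ (k - 1))"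
  show "m \<in> \<M>"
    unfolding m_def using assms by (intro M_sum M_mult' O_of_nat M_power) auto
  have "(\<Sum>k\<in>{2..<p}. of_nat (p choose k) * b ^ k) = of_nat p * b * m"
    unfolding m_def sum_distrib_left
  proof (rule sum.cong)
    fix k assume "k \<in> {2..<p}"
    then show "of_nat (p choose k) * b ^ k =
        of_nat p * b * (of_nat ((p choose k) div p) * b ^ (k - 1))"
      using power_minus_mult[of k b] by (simp add: of_nat_choose mult_ac)
  qed simp
  moreover have "(1 + b) ^ p = (b + 1) ^ p" by (simp add: add.commute)
  moreover have "\<dots> = (\<Sum>k\<in>insert 0 (insert 1 (insert p {2..<p})). of_nat (p choose k) * b ^ k)"
    by (subst binomial_ring, rule sum.cong) (use p_ge_2 in auto)
  moreover have "\<dots> = 1 + (of_nat p * b + (b ^ p + (\<Sum>k\<in>{2..<p}. of_nat (p choose k) * b ^ k)))"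
    using p_ge_2 by simp
  ultimately show "(1 + b) ^ p = 1 + b ^ p + of_nat p * b * (1 + m)"
    by (simp add: algebra_simps)
qed

section \<open>The threshold element z\<close>

definition z where "z = \<zeta> - 1"

lemma z_K: "z \<in> K" and z_not_0: "z \<noteq> 0" and z_M: "z \<in> \<M>"
  using zeta power_p_near_1[of \<zeta>] by (auto simp: z_def K_diff)

text \<open>Expanding \<open>(1 + z) ^ p = 1\<close> and cancelling z compares p with
  \<open>z ^ (p - 1)\<close>. The residue -1 of the ratio is the source of the minus sign in X^p -
  X.\<close>

lemma p_eq_z_power: "\<exists>e. e + 1 \<in> \<M> \<and> of_nat p = z ^ (p - 1) * e"
proof -
  obtain m where m: "m \<in> \<M>" "(1 + z) ^ p = 1 + z ^ p + of_nat p * z * (1 + m)"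
    using one_plus_power_p[OF z_M] by blast
  have U: "1 + m \<in> \<U>" using m U_cong[of 1 "1 + m"] by simp
  have "z * (z ^ (p - 1) + of_nat p * (1 + m)) = 0"
    using m(2) zeta(2) power_minus_mult[of p z] p_pos z_def by (simp add: distrib_left mult_ac)
  then have "z ^ (p - 1) + of_nat p * (1 + m) = 0" using z_not_0 by simp
  then have "of_nat p = z ^ (p - 1) * (- inverse (1 + m))"
    using U_not_0[OF U] by (simp add: field_simps eq_neg_iff_add_eq_0 add.commute)
  moreover have "- inverse (1 + m) + 1 = m * inverse (1 + m)"
    using U_not_0[OF U] by (simp add: field_simps)
  moreover have "m * inverse (1 + m) \<in> \<M>"
    using m U by (intro M_mult U_O U_inverse)
  ultimately show ?thesis by metis
qed

lemma one_plus_power_p':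
  assumes "b \<in> \<M>"
  shows "\<exists>e. e + 1 \<in> \<M> \<and> (1 + b) ^ p = 1 + b ^ p + z ^ (p - 1) * b * e"
proof -
  obtain m where m: "m \<in> \<M>" "(1 + b) ^ p = 1 + b ^ p + of_nat p * b * (1 + m)"
    using one_plus_power_p[OF assms] by blast
  obtain e where e: "e + 1 \<in> \<M>" "of_nat p = z ^ (p - 1) * e"
    using p_eq_z_power by blast
  have "e * (1 + m) + 1 = (e + 1) + ((e + 1) - 1) * m" by (simp add: algebra_simps)
  moreover have "((e + 1) - 1) * m \<in> \<M>"
    using e m by (intro M_mult'[OF O_diff] M_sub_O[OF e(1)]) auto
  ultimately have "e * (1 + m) + 1 \<in> \<M>" using e(1) M_add by presburger
  then show ?thesis using m e by (intro exI[of _ "e * (1 + m)"]) (simp add: mult_ac)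
qed

lemma power_p_small:
  assumes "b \<in> \<M>" "b \<noteq> 0" "z / b \<in> \<M>"
  shows "((1 + b) ^ p - 1) / b ^ p - 1 \<in> \<M>"
proof -
  obtain e where e: "e + 1 \<in> \<M>" "(1 + b) ^ p = 1 + b ^ p + z ^ (p - 1) * b * e"
    using one_plus_power_p'[OF assms(1)] by blast
  have "((1 + b) ^ p - 1) / b ^ p - 1 = (z / b) ^ (p - 1) * ((e + 1) - 1)"
    using assms(2) power_minus_mult[of p b] p_pos
    by (simp add: e field_simps power_divide)
  also have "\<dots> \<in> \<M>" using e assms p_ge_2 by (intro M_mult M_power O_diff M_sub_O[of "e + 1"]) auto
  finally show ?thesis .
qed

lemma power_p_large:
  assumes "d \<in> \<O>"
  shows "((1 + z * d) ^ p - 1) / z ^ p - (d ^ p - d) \<in> \<M>"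
proof -
  obtain e where e: "e + 1 \<in> \<M>" "(1 + z * d) ^ p = 1 + (z * d) ^ p + z ^ (p - 1) * (z * d) * e"
    using one_plus_power_p'[of "z * d"] assms M_mult[OF z_M] by blast
  have zp: "z ^ p = z ^ (p - 1) * z"
    using power_minus_mult[of p z] p_pos by simp
  have "((1 + z * d) ^ p - 1) / z ^ p - (d ^ p - d) = d * (e + 1)"
    unfolding e(2) using z_not_0 by (simp add: zp power_mult_distrib field_simps)
  also have "\<dots> \<in> \<M>" using e assms by (intro M_mult')
  finally show ?thesis .
qed

lemma AS_minus:
  assumes "x \<in> \<O>"
  shows "((- x) ^ p - (- x)) + (x ^ p - x) \<in> \<M>"
  using frobenius_minus[OF assms] by simp

text \<open>Hensel's lemma for the polynomial \<open>((1 + z X)\<^sup>p - (1 + a)) / z\<^sup>p\<close>.\<close>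
lemma hensel_power_p:
  assumes "a \<in> K" "a / z ^ p \<in> \<M>"
  shows "\<exists>g\<in>K. g ^ p = 1 + a"
proof -
  obtain e where e: "e + 1 \<in> \<M>" "of_nat p = z ^ (p - 1) * e"
    using p_eq_z_power by blast
  have eU: "e \<in> \<U>" using e U_cong[of "-1" e] by (simp add: U_minus)
  define f where "f = smult (inverse (z ^ p)) ([:1, z:] ^ p - [:1 + a:])"
  have c: "coeff f i = of_nat (p choose i) * z ^ i / z ^ p" if "i > 0" "i \<le> p" for i
    using that by (simp add: f_def coeff_linear_poly_power coeff_pCons field_simps split: nat.split)
  have c0: "coeff f 0 = - (a / z ^ p)"
    by (simp add: f_def coeff_linear_poly_power field_simps)
  have cp: "coeff f p = 1" using c[of p] p_pos z_not_0 by simp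
  have "degree ([:1, z:] ^ p) \<le> p"
    using degree_power_le[of "[:1, z:]" p] z_not_0 by simp
  then have chigh: "coeff f i = 0" if "i > p" for i
    using that by (simp add: f_def coeff_eq_0 coeff_pCons split: nat.split)
  then have "degree f = p" using cp p_pos
    by (metis degree_le le_antisym le_degree zero_neq_one)
  then have lc: "lead_coeff f = 1" using cp by simp
  \<comment> \<open>The factor p of the binomial coefficient supplies \<open>z ^ (p - 1)\<close>, so
    after division by \<open>z ^ p\<close> the power \<open>z ^ (i - 1)\<close> remains and the
    coefficient is integral.\<close>
  have cmid: "coeff f i = of_nat ((p choose i) div p) * e * z ^ (i - 1)" if "i > 0" "i < p" for i
  proof -
    have "z ^ p = z ^ (p - 1) * z" "z ^ i = z ^ (i - 1) * z"
      using that p_pos by (simp_all only: power_minus_mult)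
    then show ?thesis
      using that z_not_0 by (simp add: c of_nat_choose[OF that] e(2))
  qed
  have cO: "coeff f i \<in> val_ring w K" for i
  proof -
    have "coeff f i \<in> K"
      by (cases "i = 0"; cases "i \<le> p")
        (auto simp: c c0 chigh intro!: K_closed assms z_K)
    moreover have "coeff f i \<in> \<O>"
    proof -
      consider "i = 0" | "0 < i" "i < p" | "i = p" | "i > p" by linarith
      then show ?thesis
        by cases (auto simp: c0 cmid cp chigh O_minus intro!: O_mult O_of_nat O_power U_O[OF eU]
            M_sub_O[OF z_M] M_sub_O[OF assms(2)])
    qed
    ultimately show ?thesis by (simp add: val_ring_K)
  qed
  have "poly f 0 \<in> max_ideal w K"
    using assms z_K by (simp add: poly_0_coeff_0 c0 max_ideal_K M_minus K_closed)
  \<comment> \<open>Modulo \<M> the polynomial is X^p - X: the constant term and the coefficients of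
    index 2 to p - 1 vanish. So 0 is a simple root, with derivative \<open>e\<close> congruent to
    -1.\<close>
  moreover have "poly (pderiv f) 0 \<in> val_units w K"
  proof -
    have "1 < p" using p_ge_2 by simp
    then have "poly (pderiv f) 0 = e"
      using cmid[of 1] p_pos by (simp add: poly_0_coeff_0 coeff_pderiv)
    moreover have "e = of_nat p / z ^ (p - 1)" using e z_not_0 by simp
    ultimately show ?thesis using eU z_K by (simp add: val_units_K K_closed)
  qed
  ultimately obtain b where b: "b \<in> val_ring w K" "poly f b = 0"
    using hens[unfolded henselian_def, rule_format, of f 0] cO lc by (auto simp: val_ring_K)
  have "(1 + z * b) ^ p = 1 + a"
    using b(2) z_not_0 by (simp add: f_def mult.commute)
  then show ?thesis using b z_K by (intro bexI[of _ "1 + z * b"]) (auto simp: val_ring_K intro!: K_closed)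
qed

section \<open>Best generators and normal forms\<close>

lemma inj_zeta_power: "inj_on (\<lambda>j. \<zeta> ^ j) {..<p}"
proof (rule linorder_inj_onI')
  fix i j assume ij: "i \<in> {..<p}" "j \<in> {..<p}" "i < j"
  show "\<zeta> ^ i \<noteq> \<zeta> ^ j"
  proof
    assume eq: "\<zeta> ^ i = \<zeta> ^ j"
    have "\<zeta> \<noteq> 0" using zeta p_pos by (auto simp: zero_power)
    have "\<zeta> ^ j = \<zeta> ^ i * \<zeta> ^ (j - i)" using ij by (simp flip: power_add)
    then have 1: "\<zeta> ^ (j - i) = 1" using eq \<open>\<zeta> \<noteq> 0\<close> by simp
    obtain k n where "(j - i) * k = 1 + p * n"
      using inverse_mod_p[of "j - i"] ij by (metis diff_is_0_eq less_imp_diff_less lessThan_iff neq0_conv not_le)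
    then have "(\<zeta> ^ (j - i)) ^ k = \<zeta> * (\<zeta> ^ p) ^ n"
      by (metis power_mult power_add power_one_right)
    then show False using 1 zeta by simp
  qed
qed

text \<open>Takes the place of Galois theory: the elements \<zeta>^j x play the role of the
  conjugates of x. As polynomials in y both sides are monic of degree p with the same p
  roots.\<close>

lemma diff_power_p_factor: "y ^ p - x ^ p = (\<Prod>j<p. y - \<zeta> ^ j * x)"
proof (cases "x = 0")
  case False
  let ?A = "(\<lambda>j. \<zeta> ^ j * x) ` {..<p}"
  let ?f = "monom 1 p - [:x ^ p:]" and ?g = "\<Prod>j<p. [:- (\<zeta> ^ j * x), 1:]"
  have "inj_on (\<lambda>j. \<zeta> ^ j * x) {..<p}"
    using inj_zeta_power False by (auto simp: inj_on_def)
  then have card: "card ?A = p" by (simp add: card_image)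
  have deg_g: "degree ?g = p"
    by (subst degree_prod_sum_eq) auto
  have "lead_coeff ?g = 1" by (simp add: lead_coeff_prod)
  then have "coeff ?g p = 1" by (simp add: deg_g)
  have deg_f: "degree ?f \<le> p"
    by (intro degree_diff_le) (auto simp: degree_monom_eq)
  have "?f = ?g"
  proof (rule poly_eqI_degree_lead_coeff[of _ p _ ?A])
    show "coeff ?f p = coeff ?g p"
      using \<open>coeff ?g p = 1\<close> p_pos by (simp add: coeff_pCons split: nat.split)
    fix v assume "v \<in> ?A"
    then obtain j where j: "j < p" "v = \<zeta> ^ j * x" by auto
    have "v ^ p = (\<zeta> ^ p) ^ j * x ^ p"
      by (simp add: j power_mult_distrib flip: power_mult) (simp add: mult.commute)
    then show "poly ?f v = poly ?g v"
      using j by (auto simp: poly_monom poly_prod zeta)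
  qed (use card deg_f deg_g in auto)
  then have "poly ?f y = poly ?g y" by simp
  then show ?thesis by (simp add: poly_monom poly_prod)
qed (use p_pos in \<open>simp add: zero_power\<close>)

text \<open>\<open>ext_degree\<close> has the default value 0 when there is no finite basis, so the
  positive degree p guarantees one.\<close>

lemma finite_basis_ex: "\<exists>B. is_finite_basis K UNIV B \<and> card B = p"
proof -
  have ex: "\<exists>B. is_finite_basis K UNIV B"
    using deg p_pos by (auto simp: ext_degree_def split: if_splits)
  then show ?thesis
    using deg someI_ex[OF ex] by (auto simp: ext_degree_def)
qed

lemma K_proper: "K \<noteq> UNIV"
proof
  assume K: "K = UNIV"
  obtain B where B: "is_finite_basis K UNIV B" "card B = p"
    using finite_basis_ex by blast
  then have "card B \<ge> 2" "finite B" using p_ge_2 by (auto simp: is_finite_basis_def)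
  then obtain b b' where b: "b \<in> B" "b' \<in> B" "b \<noteq> b'"
    by (metis card_le_Suc0_iff_eq not_less_eq_eq numeral_2_eq_2)
  \<comment> \<open>Over the whole field any two elements are dependent: b' * b - b * b' =
    0.\<close>
  define c where "c = (\<lambda>x. if x = b then b' else - b)"
  have "lin_indep_over K B" using B by (simp add: is_finite_basis_def)
  from this[unfolded lin_indep_over_def, THEN spec, THEN spec, of "{b, b'}" c]
  have "c b = 0" "c b' = 0" using b K by (simp_all add: c_def)
  then show False using b by (simp add: c_def)
qed

lemma generator_notin_K:
  assumes "gen_field K \<alpha> = UNIV"
  shows "\<alpha> \<notin> K"
proof
  assume "\<alpha> \<in> K"
  then have "gen_field K \<alpha> \<subseteq> K" using subK by (auto simp: gen_field_def)
  then show False using assms K_proper by auto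
qed

lemma generates_K: "generates K p h \<Longrightarrow> h \<in> K"
  by (simp add: generates_def)

lemma generates_not_power:
  assumes "generates K p h" "g \<in> K"
  shows "g ^ p \<noteq> h"
proof
  assume g: "g ^ p = h"
  obtain \<alpha> where \<alpha>: "\<alpha> ^ p = h" "gen_field K \<alpha> = UNIV"
    using assms by (auto simp: generates_def)
  have "(\<Prod>j<p. \<alpha> - \<zeta> ^ j * g) = 0"
    using diff_power_p_factor[of \<alpha> g] g \<alpha> by simp
  then obtain j where "\<alpha> = \<zeta> ^ j * g" by auto
  then have "\<alpha> \<in> K" using assms zeta by (auto intro: K_closed)
  then show False using generator_notin_K \<alpha> by blast
qed

lemma generates_not_0: "generates K p h \<Longrightarrow> h \<noteq> 0"
  and generates_not_1: "generates K p h \<Longrightarrow> h \<noteq> 1"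
  using generates_not_power[of h 0] generates_not_power[of h 1] p_pos by (auto simp: zero_power)

lemma gen_field_eq_UNIV_iff:
  "gen_field K \<alpha> = UNIV \<longleftrightarrow> (\<forall>F. is_subfield F \<and> K \<subseteq> F \<and> \<alpha> \<in> F \<longrightarrow> F = UNIV)"
  by (auto simp: gen_field_def)

lemma generates_mult_power:
  assumes "generates K p h" "g \<in> K" "g \<noteq> 0"
  shows "generates K p (h * g ^ p)"
proof -
  obtain \<alpha> where \<alpha>: "\<alpha> ^ p = h" "gen_field K \<alpha> = UNIV"
    using assms by (auto simp: generates_def)
  have "gen_field K (\<alpha> * g) = UNIV"
    unfolding gen_field_eq_UNIV_iff
  proof (intro allI impI, elim conjE)
    fix F assume F: "is_subfield F" "K \<subseteq> F" "\<alpha> * g \<in> F"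
    then have "\<alpha> * g * inverse g \<in> F" using assms by (auto simp: is_subfield_def)
    then have "\<alpha> \<in> F" using assms(3) by (simp add: mult.assoc)
    then show "F = UNIV" using \<alpha>(2) F assms by (auto simp: gen_field_eq_UNIV_iff)
  qed
  then show ?thesis using \<alpha> assms
    unfolding generates_def by (auto simp: power_mult_distrib intro!: K_closed exI[of _ "\<alpha> * g"])
qed

lemma generates_inverse:
  assumes "generates K p h"
  shows "generates K p (inverse h)"
proof -
  obtain \<alpha> where \<alpha>: "\<alpha> ^ p = h" "gen_field K \<alpha> = UNIV"
    using assms by (auto simp: generates_def)
  have "gen_field K (inverse \<alpha>) = UNIV"
    unfolding gen_field_eq_UNIV_iff
  proof (intro allI impI, elim conjE)
    fix F assume F: "is_subfield F" "K \<subseteq> F" "inverse \<alpha> \<in> F"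
    then have "inverse (inverse \<alpha>) \<in> F" unfolding is_subfield_def by blast
    then show "F = UNIV" using \<alpha>(2) F by (auto simp: gen_field_eq_UNIV_iff)
  qed
  then show ?thesis using \<alpha> assms
    unfolding generates_def by (auto simp: power_inverse intro!: K_closed exI[of _ "inverse \<alpha>"])
qed

section \<open>Maximality of w (h - 1) for the five forms\<close>

lemma not_p_div_val_iff:
  assumes "x \<noteq> 0"
  shows "not_p_div_val w K p x \<longleftrightarrow> (\<forall>y\<in>K. y \<noteq> 0 \<longrightarrow> x / y ^ p \<notin> \<U>)"
proof -
  have "w x = w (y ^ p) \<longleftrightarrow> x / y ^ p \<in> \<U>" if "y \<noteq> 0" for y
    using w_eq_iff[of "y ^ p" x] assms that by auto
  then show ?thesis by (auto simp: not_p_div_val_def)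
qed

lemma not_pth_powerD:
  "res_not_pth_power w K p u \<Longrightarrow> u \<in> K \<Longrightarrow> x \<in> K \<Longrightarrow> x \<in> \<O> \<Longrightarrow> u - x ^ p \<notin> \<M>"
  by (auto simp: res_not_pth_power_def val_ring_K max_ideal_K K_closed)

lemma not_ASD:
  "res_not_AS w K p c \<Longrightarrow> c \<in> K \<Longrightarrow> x \<in> K \<Longrightarrow> x \<in> \<O> \<Longrightarrow> c - (x ^ p - x) \<notin> \<M>"
  by (auto simp: res_not_AS_def val_ring_K max_ideal_K K_closed)

text \<open>Raising to the power \<open>j\<close> with \<open>i j \<equiv> 1 (mod p)\<close> reduces \<open>h\<^sup>i g\<^sup>p\<close> to the case \<open>i = 1\<close>.\<close>
lemma reduce_exponent:
  assumes "h \<in> K" "h \<noteq> 0" "g \<in> K" "g \<noteq> 0" "i \<in> {1..p-1}" "a \<in> \<O>" "m \<in> \<M>"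
    and eq: "h ^ i * g ^ p = 1 + a * m"
  shows "\<exists>g'\<in>K - {0}. \<exists>m'\<in>\<M>. h * g' ^ p = 1 + a * m'"
proof -
  obtain j n where jn: "i * j = 1 + p * n"
    using inverse_mod_p[of i] assms(5) p_pos
    by (metis Suc_leI atLeastAtMost_iff diff_Suc_1 diff_less le_less_trans less_one not_less_eq_eq not_le)
  obtain m' where m': "m' \<in> \<M>" "(1 + a * m) ^ j = 1 + a * m'"
    using one_M_power assms by blast
  have "(h ^ i * g ^ p) ^ j = h ^ (i * j) * (g ^ j) ^ p"
    by (simp add: power_mult_distrib flip: power_mult) (simp add: mult.commute)
  also have "\<dots> = h * (h ^ n * g ^ j) ^ p"
    by (simp add: jn power_mult_distrib mult.commute[of p n] power_mult)
  finally have "h * (h ^ n * g ^ j) ^ p = 1 + a * m'" using eq m' by simp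
  moreover have "h ^ n * g ^ j \<in> K - {0}" using assms by (auto intro: K_closed)
  ultimately show ?thesis using m'(1) by blast
qed

text \<open>\<open>reduce_exponent\<close> brings the exponent down to 1; integrality of
  \<open>h\<close> is what allows the choice a = h - 1 there.\<close>

lemma best_genI:
  assumes "generates K p h" "h \<in> \<O>"
    and max: "\<And>g. g \<in> K \<Longrightarrow> g \<noteq> 0 \<Longrightarrow> (h * g ^ p - 1) / (h - 1) \<notin> \<M>"
  shows "best_gen w K p h"
  unfolding best_gen_def
proof (intro conjI ballI)
  fix g i assume g: "g \<in> K - {0}" and i: "i \<in> {1..p-1}"
  have h1: "h - 1 \<noteq> 0" using generates_not_1 assms(1) by auto
  define m where "m = (h ^ i * g ^ p - 1) / (h - 1)"
  have eq: "h ^ i * g ^ p = 1 + (h - 1) * m" using h1 by (simp add: m_def)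
  have "m \<notin> \<M>"
  proof
    assume "m \<in> \<M>"
    then obtain g' m' where "g' \<in> K - {0}" "m' \<in> \<M>" "h * g' ^ p = 1 + (h - 1) * m'"
      using reduce_exponent[of h g i "h - 1" m] assms g i eq generates_K generates_not_0 O_diff[of h 1]
      by auto
    then show False using max[of g'] h1 by auto
  qed
  \<comment> \<open>The value at 0 is arbitrary, so this element must be known to be nonzero before
    its value is compared.\<close>
  moreover from this have "h ^ i * g ^ p - 1 \<noteq> 0" by (auto simp: m_def)
  ultimately show "w (h ^ i * g ^ p - 1) \<le> w (h - 1)"
    using w_less_iff[OF h1] by (simp add: m_def not_less[symmetric])
qed (rule assms(1))

text \<open>An improving factor \<open>g = 1 + b\<close> must satisfy \<open>g ^ p - 1\<close> = -a
  up to terms of larger value. Comparing -a with the two possible leading terms of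
  \<open>(1 + b) ^ p - 1\<close> gives the alternatives; each of the forms (iii)-(v) excludes
  both.\<close>

lemma shift_cases:
  assumes h: "h = 1 + a" "a \<in> K" "a \<in> \<M>" "a \<noteq> 0" and g: "g \<in> K" "(h * g ^ p - 1) / a \<in> \<M>"
  shows "(\<exists>b\<in>K. b \<noteq> 0 \<and> z / b \<in> \<M> \<and> a / b ^ p + 1 \<in> \<M>) \<or>
    (\<exists>d\<in>K. d \<in> \<O> \<and> a / z ^ p + (d ^ p - d) \<in> \<M>)"
proof -
  define m where "m = (h * g ^ p - 1) / a"
  have m: "m \<in> \<M>" using g by (simp add: m_def)
  have hU: "h \<in> \<U>" using U_cong[of 1 h] h by simp
  define b where "b = g - 1"
  \<comment> \<open>This is \<open>(g ^ p - 1) / a\<close>. It is congruent to -1 because the term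
    \<open>a\<close> has to cancel in (1 + a) (1 + a \<nu>) = 1 + a m.\<close>
  define \<nu> where "\<nu> = (m - 1) / h"
  have hg: "h * g ^ p = 1 + a * m" using h by (simp add: m_def)
  have "g ^ p - 1 = (h * g ^ p - h) / h" using U_not_0[OF hU] by (simp add: diff_divide_distrib)
  also have "\<dots> = a * \<nu>"
    by (simp only: hg \<nu>_def) (simp add: h algebra_simps)
  finally have eq: "(1 + b) ^ p - 1 = a * \<nu>" by (simp add: b_def)
  have "\<nu> + 1 = (m + a) / h" using U_not_0[OF hU] by (simp add: \<nu>_def h field_simps)
  also have "\<dots> \<in> \<M>" unfolding divide_inverse
    by (intro M_mult M_add[OF m h(3)] U_O[OF U_inverse[OF hU]])
  finally have \<nu>M: "\<nu> + 1 \<in> \<M>" .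
  then have \<nu>U: "\<nu> \<in> \<U>" using U_cong[of "-1" \<nu>] by (simp add: U_minus)
  note \<nu>0 = U_not_0[OF \<nu>U] and \<nu>inv = U_O[OF U_inverse[OF \<nu>U]]
  have "g ^ p - 1 \<in> \<M>" using eq M_mult[OF h(3) U_O[OF \<nu>U]] by (simp add: b_def)
  then have b: "b \<in> K" "b \<in> \<M>" using power_p_near_1 g by (auto simp: b_def intro: K_closed)
  show ?thesis
  proof (cases "b \<noteq> 0 \<and> z / b \<in> \<M>")
    case True
    define X where "X = ((1 + b) ^ p - 1) / b ^ p"
    have X: "X - 1 \<in> \<M>" using power_p_small b True by (simp add: X_def)
    have "a / b ^ p + 1 = ((X - 1) + (\<nu> + 1)) / \<nu>"
      using True \<nu>0 by (simp add: X_def eq field_simps)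
    also have "\<dots> \<in> \<M>" unfolding divide_inverse by (intro M_mult M_add[OF X \<nu>M] \<nu>inv)
    finally show ?thesis using b True by blast
  next
    case False
    define d where "d = b / z"
    have "inverse d = z / b" by (simp add: d_def)
    then have d: "d \<in> \<O>" "d \<in> K"
      using False not_O[of d] b z_K by (auto simp: d_def intro!: K_closed)
    have bd: "b = z * d" using z_not_0 by (simp add: d_def)
    define Y where "Y = a * \<nu> / z ^ p"
    have Y: "Y - (d ^ p - d) \<in> \<M>" using power_p_large[OF d(1)] by (simp add: Y_def bd flip: eq)
    have "d ^ p - d \<in> \<O>" using d by (intro O_diff O_power)
    then have YO: "Y \<in> \<O>"
      using O_add[OF M_sub_O[OF Y], of "d ^ p - d"] by simp
    have "a / z ^ p + (d ^ p - d) = Y * (\<nu> + 1) * inverse \<nu> - (Y - (d ^ p - d))"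
      using \<nu>0 z_not_0 by (simp add: Y_def field_simps)
    also have "\<dots> \<in> \<M>" by (intro M_diff M_mult[OF M_mult'[OF YO \<nu>M] \<nu>inv] Y)
    finally show ?thesis using d by blast
  qed
qed

text \<open>The first alternative of \<open>shift_cases\<close> would make \<open>w t\<close> the
  value of a p-th power from K; the second would force \<open>a / z ^ p\<close> to be integral,
  although a lies below the threshold.\<close>

lemma best_iii:
  assumes "generates K p h" "prop_iii w K p z h"
  shows "best_gen w K p h"
proof -
  obtain c t where ct: "c \<in> K" "c \<in> \<U>" "t \<in> K" "t \<in> \<M>" "t \<noteq> 0" "h = 1 + c * t" "w t < w (z ^ p)"
    "not_p_div_val w K p t"
    using assms(2) by (auto simp: prop_iii_def val_units_K max_ideal_K)
  define a where "a = c * t"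
  have a: "h = 1 + a" "a \<in> K" "a \<in> \<M>" "a \<noteq> 0"
    using ct U_O U_not_0 by (auto simp: a_def intro: K_closed M_mult')
  have "z ^ p / t * inverse c \<in> \<M>" using ct z_not_0 U_O[OF U_inverse]
    by (intro M_mult) (auto simp: w_less_iff)
  then have za: "inverse (a / z ^ p) \<in> \<M>" by (simp add: a_def field_simps)
  show ?thesis
  proof (rule best_genI[OF assms(1)])
    show "h \<in> \<O>" using a by (auto intro: O_add M_sub_O)
    fix g assume g: "g \<in> K" "g \<noteq> 0"
    show "(h * g ^ p - 1) / (h - 1) \<notin> \<M>"
    proof
      assume "(h * g ^ p - 1) / (h - 1) \<in> \<M>"
      then consider b where "b \<in> K" "b \<noteq> 0" "a / b ^ p + 1 \<in> \<M>"
        | d where "d \<in> \<O>" "a / z ^ p + (d ^ p - d) \<in> \<M>"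
        using shift_cases[OF a g(1)] a(1) by auto
      then show False
      proof cases
        case 1
        then have "a / b ^ p \<in> \<U>" using U_cong[of "-1" "a / b ^ p"] by (simp add: U_minus)
        then have "a / b ^ p * inverse c \<in> \<U>" using ct U_mult U_inverse by blast
        then have "t / b ^ p \<in> \<U>" using ct U_not_0 by (simp add: a_def field_simps)
        then show False using ct 1 not_p_div_val_iff by blast
      next
        case 2
        then have "(a / z ^ p + (d ^ p - d)) - (d ^ p - d) \<in> \<O>"
          by (intro O_diff O_power) (auto intro: M_sub_O)
        then show False using za inverse_O[of "a / z ^ p"] a z_not_0 by simp
      qed
    qed
  qed
qed

lemma best_iv:
  assumes "generates K p h" "prop_iv w K p z h"
  shows "best_gen w K p h"
proof -
  obtain u s where us: "u \<in> K" "u \<in> \<U>" "s \<in> K" "s \<in> \<M>" "s \<noteq> 0" "h = 1 + u * s ^ p" "w s < w z"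
    "res_not_pth_power w K p u"
    using assms(2) by (auto simp: prop_iv_def val_units_K max_ideal_K)
  define a where "a = u * s ^ p"
  have a: "h = 1 + a" "a \<in> K" "a \<in> \<M>" "a \<noteq> 0"
    using us U_O U_not_0 p_pos by (auto simp: a_def intro: K_closed M_mult' M_power)
  have "(z / s) ^ p * inverse u \<in> \<M>" using us z_not_0 U_O[OF U_inverse] p_pos
    by (intro M_mult M_power) (auto simp: w_less_iff)
  then have za: "inverse (a / z ^ p) \<in> \<M>" by (simp add: a_def field_simps)
  show ?thesis
  proof (rule best_genI[OF assms(1)])
    show "h \<in> \<O>" using a by (auto intro: O_add M_sub_O)
    fix g assume g: "g \<in> K" "g \<noteq> 0"
    show "(h * g ^ p - 1) / (h - 1) \<notin> \<M>"
    proof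
      assume "(h * g ^ p - 1) / (h - 1) \<in> \<M>"
      then consider b where "b \<in> K" "b \<noteq> 0" "a / b ^ p + 1 \<in> \<M>"
        | d where "d \<in> \<O>" "a / z ^ p + (d ^ p - d) \<in> \<M>"
        using shift_cases[OF a g(1)] a(1) by auto
      then show False
      proof cases
        case 1
        define y where "y = b / s"
        have y: "y \<in> K" "y \<noteq> 0" using 1 us by (auto simp: y_def intro: K_closed)
        have uy: "u / y ^ p + 1 \<in> \<M>" using 1 us by (simp add: a_def y_def power_divide)
        then have "u / y ^ p \<in> \<U>" using U_cong[of "-1" "u / y ^ p"] by (simp add: U_minus)
        then have "y ^ p \<in> \<U>" using us U_divide[of u "u / y ^ p"] U_not_0[of u] by simp
        then have yU: "y \<in> \<U>" using U_power_iff p_pos by blast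
        \<comment> \<open>The alternative says that u is congruent to -y^p, and the sign moves
          inside the power only modulo \<M>.\<close>
        have "u - (- y) ^ p = (u / y ^ p + 1) * y ^ p - ((- y) ^ p + y ^ p)"
          using y by (simp add: field_simps)
        also have "\<dots> \<in> \<M>" using uy yU by (intro M_diff M_mult frobenius_minus O_power U_O)
        finally show False using not_pth_powerD[OF us(8,1), of "- y"] y U_O[OF yU]
          by (auto simp: O_minus K_closed)
      next
        case 2
        then have "(a / z ^ p + (d ^ p - d)) - (d ^ p - d) \<in> \<O>"
          by (intro O_diff O_power) (auto intro: M_sub_O)
        then show False using za inverse_O[of "a / z ^ p"] a z_not_0 by simp
      qed
    qed
  qed
qed

text \<open>The first alternative of \<open>shift_cases\<close> is impossible by size:
  \<open>(z / b) ^ p\<close> would be a unit although \<open>z / b\<close> is in \<M>. The second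
  would solve the Artin-Schreier congruence for c by -d.\<close>

lemma best_v:
  assumes "generates K p h" "prop_v w K p z h"
  shows "best_gen w K p h"
proof -
  obtain c where c: "c \<in> K" "c \<in> \<U>" "h = 1 + c * z ^ p" "res_not_AS w K p c"
    using assms(2) by (auto simp: prop_v_def val_units_K)
  define a where "a = c * z ^ p"
  have a: "h = 1 + a" "a \<in> K" "a \<in> \<M>" "a \<noteq> 0"
    using c U_O U_not_0 p_pos z_not_0 z_K by (auto simp: a_def intro!: K_closed M_mult' M_power z_M)
  show ?thesis
  proof (rule best_genI[OF assms(1)])
    show "h \<in> \<O>" using a by (auto intro: O_add M_sub_O)
    fix g assume g: "g \<in> K" "g \<noteq> 0"
    show "(h * g ^ p - 1) / (h - 1) \<notin> \<M>"
    proof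
      assume "(h * g ^ p - 1) / (h - 1) \<in> \<M>"
      then consider b where "b \<in> K" "b \<noteq> 0" "z / b \<in> \<M>" "a / b ^ p + 1 \<in> \<M>"
        | d where "d \<in> \<O>" "d \<in> K" "a / z ^ p + (d ^ p - d) \<in> \<M>"
        using shift_cases[OF a g(1)] a(1) by auto
      then show False
      proof cases
        case 1
        then have "a / b ^ p \<in> \<U>" using U_cong[of "-1" "a / b ^ p"] by (simp add: U_minus)
        then have "a / b ^ p * inverse c \<in> \<U>" using c U_mult U_inverse by blast
        then have "(z / b) ^ p \<in> \<U>" using c U_not_0 by (simp add: a_def field_simps)
        then show False using 1 U_power_iff[OF p_pos] U_not_M by blast
      next
        case 2
        have "c - ((- d) ^ p - (- d)) = (a / z ^ p + (d ^ p - d)) - (((- d) ^ p - (- d)) + (d ^ p - d))"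
          using z_not_0 by (simp add: a_def)
        also have "\<dots> \<in> \<M>" using 2 by (intro M_diff AS_minus)
        finally show False using not_ASD[OF c(4,1), of "- d"] 2 by (auto simp: O_minus K_closed)
      qed
    qed
  qed
qed

text \<open>Here h lies in \<M> and h - 1 is a unit, so an improvement would turn
  \<open>h * g ^ p\<close> into a one-unit and make \<open>w h\<close> the value of a p-th
  power.\<close>

lemma best_i:
  assumes "generates K p h" "h \<in> \<O>" "prop_i w K p h"
  shows "best_gen w K p h"
proof (rule best_genI[OF assms(1,2)])
  fix g assume g: "g \<in> K" "g \<noteq> 0"
  have ndiv: "h / y ^ p \<notin> \<U>" if "y \<in> K" "y \<noteq> 0" for y
    using assms(3) that not_p_div_val_iff[OF generates_not_0[OF assms(1)]] by (simp add: prop_i_def)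
  have "h \<in> \<M>" using ndiv[of 1] assms(2) by (simp add: unit_O_def)
  then have "h - 1 \<in> \<U>" using U_cong[of "-1" "h - 1"] by (simp add: U_minus)
  show "(h * g ^ p - 1) / (h - 1) \<notin> \<M>"
  proof
    assume "(h * g ^ p - 1) / (h - 1) \<in> \<M>"
    then have "(h * g ^ p - 1) / (h - 1) * (h - 1) \<in> \<M>"
      using \<open>h - 1 \<in> \<U>\<close> by (intro M_mult U_O)
    then have "h * g ^ p \<in> \<U>"
      using U_not_0[OF \<open>h - 1 \<in> \<U>\<close>] U_cong[of 1 "h * g ^ p"] by simp
    then show False using ndiv[of "inverse g"] g by (simp add: K_closed power_inverse divide_inverse)
  qed
qed

lemma best_ii:
  assumes "generates K p h" "prop_ii w K p h"
  shows "best_gen w K p h"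
proof -
  have h: "h \<in> K" "h \<in> \<U>" "res_not_pth_power w K p h"
    using assms(2) by (auto simp: prop_ii_def val_units_K)
  have "h - 1 \<notin> \<M>" using not_pth_powerD[OF h(3,1), of 1] by simp
  then have hU: "h - 1 \<in> \<U>" using h by (auto simp: unit_O_def intro: O_diff)
  show ?thesis
  proof (rule best_genI[OF assms(1)])
    show "h \<in> \<O>" using h U_O by blast
    fix g assume g: "g \<in> K" "g \<noteq> 0"
    show "(h * g ^ p - 1) / (h - 1) \<notin> \<M>"
    proof
      assume "(h * g ^ p - 1) / (h - 1) \<in> \<M>"
      then have "(h * g ^ p - 1) / (h - 1) * (h - 1) \<in> \<M>"
        using hU by (intro M_mult U_O)
      then have hg: "h * g ^ p - 1 \<in> \<M>" using U_not_0[OF hU] by simp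
      then have "h * g ^ p \<in> \<U>" using U_cong[of 1 "h * g ^ p"] by simp
      then have "g ^ p \<in> \<U>" using U_divide[of "h * g ^ p" h] h U_not_0 by simp
      then have gU: "inverse g \<in> \<U>" using U_power_iff[OF p_pos] U_inverse by blast
      have "h - inverse g ^ p = (h * g ^ p - 1) * inverse g ^ p"
        using g by (simp add: field_simps)
      also have "\<dots> \<in> \<M>" using hg gU by (intro M_mult O_power U_O)
      finally show False using not_pth_powerD[OF h(3,1), of "inverse g"] g gU U_O
        by (auto simp: K_closed)
    qed
  qed
qed

section \<open>Reduction of a generator to one of the five forms\<close>

definition normal_form where
  "normal_form h \<longleftrightarrow> h \<in> \<O> \<and> (prop_i w K p h \<or> prop_ii w K p h \<or> prop_iii w K p z h \<or>
     prop_iv w K p z h \<or> prop_v w K p z h)"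

lemma normal_form_imp_best: "generates K p h \<Longrightarrow> normal_form h \<Longrightarrow> best_gen w K p h"
  using best_i best_ii best_iii best_iv best_v by (auto simp: normal_form_def)

text \<open>Two obstructions stand in the way of moving h close to 1 by p-th powers: its value,
  giving (i), and then the residue of the remaining unit, giving (ii).\<close>

lemma normal_form_or_near_1:
  assumes "generates K p h"
  shows "(\<exists>h'. generates K p h' \<and> normal_form h') \<or> (\<exists>g\<in>K. g \<noteq> 0 \<and> h * g ^ p - 1 \<in> \<M>)"
proof -
  note hK = generates_K[OF assms] and h0 = generates_not_0[OF assms]
  show ?thesis
  proof (cases "not_p_div_val w K p h")
    case True
    then have ndiv: "\<And>y. y \<in> K \<Longrightarrow> y \<noteq> 0 \<Longrightarrow> h / y ^ p \<notin> \<U>"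
      using not_p_div_val_iff h0 by blast
    show ?thesis
    proof (cases "h \<in> \<O>")
      case True
      then show ?thesis
        using \<open>not_p_div_val w K p h\<close> assms by (auto simp: normal_form_def prop_i_def)
    next
      case False
      \<comment> \<open>Form (i) is the only one that does not imply integrality, which (b) demands.
        If h is not integral, its inverse is, and it generates the same extension.\<close>
      have "not_p_div_val w K p (inverse h)"
        using ndiv[of "inverse _"] h0 U_inverse
        by (subst not_p_div_val_iff) (force simp: K_closed power_inverse field_simps)+
      moreover have "inverse h \<in> \<O>" using not_O[OF False] M_sub_O by blast
      ultimately show ?thesis
        using generates_inverse[OF assms] by (auto simp: normal_form_def prop_i_def)
    qed
  next
    case False
    then obtain y where y: "y \<in> K" "y \<noteq> 0" "h / y ^ p \<in> \<U>"
      using not_p_div_val_iff h0 by blast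
    define u where "u = h * (inverse y) ^ p"
    have u: "u \<in> \<U>" "u \<in> K" using y hK by (auto simp: u_def power_inverse divide_inverse intro: K_closed)
    have gu: "generates K p u" using assms y generates_mult_power by (simp add: u_def K_closed)
    show ?thesis
    proof (cases "res_not_pth_power w K p u")
      case True
      then show ?thesis using u gu U_O by (auto simp: normal_form_def prop_ii_def val_units_K)
    next
      case False
      then obtain x where x: "x \<in> K" "x \<in> \<O>" "u - x ^ p \<in> \<M>"
        by (auto simp: res_not_pth_power_def val_ring_K max_ideal_K)
      then have "x ^ p \<in> \<U>" using U_cong[OF u(1), of "x ^ p"] M_minus[of "u - x ^ p"] by simp
      then have xU: "x \<in> \<U>" using U_power_iff p_pos by blast
      have "h * (inverse (y * x)) ^ p - 1 = (u - x ^ p) * inverse x ^ p"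
        using U_not_0[OF xU] y by (simp add: u_def field_simps)
      also have "\<dots> \<in> \<M>" using x xU by (intro M_mult O_power U_O U_inverse)
      finally show ?thesis using x y U_not_0[OF xU] by (intro disjI2 bexI[of _ "inverse (y * x)"]) (auto intro!: K_closed)
    qed
  qed
qed

text \<open>Improvement is possible only strictly below the threshold. At the threshold a solution
  of the Artin-Schreier congruence already makes h a p-th power by Hensel's lemma, and beyond it h
  is one anyway. The recorded inequality \<open>z ^ p / (h - 1) \<in> \<M>\<close> is used again
  when the root is approximated.\<close>

lemma normal_form_or_improvable:
  assumes gen: "generates K p h" and near: "h - 1 \<in> \<M>"
  shows "normal_form h \<or> z ^ p / (h - 1) \<in> \<M> \<and> (\<exists>g\<in>K. g \<noteq> 0 \<and> (h * g ^ p - 1) / (h - 1) \<in> \<M>)"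
proof -
  define a where "a = h - 1"
  have a: "a \<in> K" "a \<in> \<M>" "a \<noteq> 0" "h = 1 + a"
    using near generates_K[OF gen] generates_not_1[OF gen] by (auto simp: a_def K_closed)
  have hO: "h \<in> \<O>" using a by (auto intro: O_add M_sub_O)
  have "a / z ^ p \<notin> \<M>"
    using hensel_power_p[of a] a generates_not_power[OF gen] by auto
  show ?thesis
  proof (cases "z ^ p / a \<in> \<M>")
    case False
    define c where "c = a / z ^ p"
    have "inverse c = z ^ p / a" by (simp add: c_def)
    then have cU: "c \<in> \<U>" using not_O[of c] False \<open>a / z ^ p \<notin> \<M>\<close> unfolding unit_O_def c_def by auto
    have c: "a = c * z ^ p" "c \<in> K" using z_not_0 z_K a by (auto simp: c_def intro: K_closed)
    have "res_not_AS w K p c"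
    proof (rule ccontr)
      assume "\<not> res_not_AS w K p c"
      then obtain x where x: "x \<in> K" "x \<in> \<O>" "c - (x ^ p - x) \<in> \<M>"
        by (auto simp: res_not_AS_def val_ring_K max_ideal_K)
      \<comment> \<open>\<open>power_p_large\<close> gives g^p = 1 - z^p (x^p - x) up to terms of
        larger value than \<open>z ^ p\<close>; this cancels \<open>c * z ^ p\<close> and pushes
        \<open>h * g ^ p\<close> beyond the threshold.\<close>
      define g where "g = 1 + z * (- x)"
      define Q where "Q = (g ^ p - 1) / z ^ p"
      have Q: "Q - ((- x) ^ p - (- x)) \<in> \<M>"
        using power_p_large[of "- x"] x by (simp add: Q_def g_def O_minus)
      have "(Q - ((- x) ^ p - (- x))) + (((- x) ^ p - (- x)) + (x ^ p - x)) + (c - (x ^ p - x)) \<in> \<M>"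
        using Q x by (intro M_add AS_minus)
      then have Qc: "Q + c \<in> \<M>" by (simp add: algebra_simps)
      have "- c \<in> \<U>" using cU by (simp add: U_minus)
      then have QO: "Q \<in> \<O>" using U_cong[of "- c" Q] Qc U_O by simp
      have "h * g ^ p - 1 = (1 + a) * (1 + z ^ p * Q) - 1"
        using z_not_0 by (simp add: a Q_def)
      then have "(h * g ^ p - 1) / z ^ p = (Q + c) + a * Q"
        using z_not_0 by (simp add: c(1) field_simps)
      also have "\<dots> \<in> \<M>" by (intro M_add[OF Qc] M_mult[OF a(2) QO])
      finally have M: "(h * g ^ p - 1) / z ^ p \<in> \<M>" .
      have g: "g \<in> K" using x z_K by (auto simp: g_def intro!: K_closed)
      have g0: "g \<noteq> 0"
        using M_mult[OF z_M x(2)] by (auto simp: g_def)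
      have "\<exists>g'\<in>K. g' ^ p = 1 + (h * g ^ p - 1)"
        using M g generates_K[OF gen] by (intro hensel_power_p) (auto intro!: K_closed)
      then show False
        using generates_not_power[OF generates_mult_power[OF gen g g0]] by auto
    qed
    then have "prop_v w K p z h" using c cU a by (auto simp: prop_v_def val_units_K)
    then show ?thesis using hO by (simp add: normal_form_def)
  next
    case True
    then have wa: "w a < w (z ^ p)" using a z_not_0 by (simp add: w_less_iff)
    show ?thesis
    proof (cases "not_p_div_val w K p a")
      case True
      then have "prop_iii w K p z h"
        unfolding prop_iii_def using a wa
        by (intro bexI[of _ 1] bexI[of _ a]) (auto simp: val_units_K max_ideal_K M_iff)
      then show ?thesis using hO by (simp add: normal_form_def)
    next
      case False
      then obtain s where s: "s \<in> K" "s \<noteq> 0" "a / s ^ p \<in> \<U>"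
        using not_p_div_val_iff a by blast
      define u where "u = a / s ^ p"
      have u: "u \<in> K" "u \<in> \<U>" "a = u * s ^ p" using s a by (auto simp: u_def intro: K_closed)
      have "s ^ p = a * inverse u" using u U_not_0 by simp
      then have "s ^ p \<in> \<M>" using a u M_mult U_O U_inverse by metis
      then have sM: "s \<in> \<M>" using M_power_iff p_pos by blast
      have "(z / s) ^ p = z ^ p / a * u" using u s U_not_0 by (simp add: field_simps)
      then have "(z / s) ^ p \<in> \<M>" using True u M_mult U_O by metis
      then have zs: "z / s \<in> \<M>" using M_power_iff p_pos by blast
      show ?thesis
      proof (cases "res_not_pth_power w K p u")
        case True
        then have "prop_iv w K p z h"
          unfolding prop_iv_def using u s sM zs a z_not_0
          by (intro bexI[of _ u] bexI[of _ s]) (auto simp: val_units_K max_ideal_K M_iff w_less_iff)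
        then show ?thesis using hO by (simp add: normal_form_def)
      next
        case False
        then obtain x where x: "x \<in> K" "x \<in> \<O>" "u - x ^ p \<in> \<M>"
          by (auto simp: res_not_pth_power_def val_ring_K max_ideal_K)
        then have "x ^ p \<in> \<U>" using U_cong[OF u(2), of "x ^ p"] M_minus[of "u - x ^ p"] by simp
        then have xU: "x \<in> \<U>" using U_power_iff p_pos by blast
        \<comment> \<open>Chosen so that b^p is -u s^p up to terms of larger value, and hence
          cancels the leading term \<open>a\<close>. The three summands of \<open>Y\<close> below
          are the errors from u + y, from the quotient \<open>Q\<close> and from the cross
          term.\<close>
        define b where "b = s * (- x)"
        have b: "b \<in> K" "b \<in> \<M>" "b \<noteq> 0"
          using s sM x U_not_0[OF xU] by (auto simp: b_def M_minus intro!: K_closed M_mult)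
        have "z / b = z / s * (- inverse x)" by (simp add: b_def divide_inverse)
        also have "\<dots> \<in> \<M>" using zs U_O[OF U_inverse[OF xU]] by (intro M_mult) (auto simp: O_minus)
        finally have zb: "z / b \<in> \<M>" .
        define Q where "Q = ((1 + b) ^ p - 1) / b ^ p"
        have Q: "Q - 1 \<in> \<M>" using power_p_small[OF b(2,3) zb] by (simp add: Q_def)
        then have QO: "Q \<in> \<O>" using U_cong[of 1 Q] U_O by simp
        define y where "y = (- x) ^ p"
        have yO: "y \<in> \<O>" using x by (simp add: y_def O_power O_minus)
        have uy: "u + y \<in> \<M>"
          using M_add[OF x(3) frobenius_minus[OF x(2)]] by (simp add: y_def)
        have bp: "b ^ p = s ^ p * y" by (simp add: b_def y_def power_mult_distrib[symmetric])
        define Y where "Y = (u + y) + y * (Q - 1) + a * y * Q"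
        have Y: "Y \<in> \<M>" unfolding Y_def
          by (intro M_add[OF M_add[OF uy]] M_mult'[OF yO Q] M_mult[OF M_mult[OF a(2) yO] QO])
        have "h * (1 + b) ^ p - 1 = (1 + a) * (1 + b ^ p * Q) - 1"
          using b by (simp add: a Q_def)
        also have "\<dots> = s ^ p * Y"
          unfolding Y_def bp by (simp add: u(3) algebra_simps)
        finally have "(h * (1 + b) ^ p - 1) / a = Y * inverse u"
          using s U_not_0[OF u(2)] by (simp add: u(3) divide_inverse)
        also have "\<dots> \<in> \<M>" by (intro M_mult[OF Y] U_O[OF U_inverse[OF u(2)]])
        finally have "(h * (1 + b) ^ p - 1) / a \<in> \<M>" .
        moreover have "1 + b \<in> \<U>" using U_cong[of 1 "1 + b"] b(2) by simp
        then have "1 + b \<noteq> 0" by (rule U_not_0)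
        moreover have "1 + b \<in> K" using b by (intro K_add) auto
        ultimately show ?thesis using True unfolding a_def by blast
      qed
    qed
  qed
qed

text \<open>The normal form may belong to another generator: if u is as in (ii) and g is a nonzero
  element of \<M> in K, then u g^p is also best, with w (u g^p - 1) = 0, but has none of the five
  forms.\<close>

lemma best_imp_normal_form:
  assumes "best_gen w K p h"
  shows "\<exists>h. generates K p h \<and> normal_form h"
proof (rule ccontr)
  assume no: "\<not> ?thesis"
  have gen: "generates K p h" using assms by (simp add: best_gen_def)
  have h1: "h - 1 \<noteq> 0" using generates_not_1[OF gen] by simp
  have max: "(h * g ^ p - 1) / (h - 1) \<notin> \<M>" if "g \<in> K" "g \<noteq> 0" for g
  proof
    assume M: "(h * g ^ p - 1) / (h - 1) \<in> \<M>"
    have "h * g ^ p - 1 \<noteq> 0"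
      using generates_not_1[OF generates_mult_power[OF gen that]] by simp
    then have "w (h - 1) < w (h ^ 1 * g ^ p - 1)" using M h1 by (simp add: w_less_iff)
    moreover have "w (h ^ 1 * g ^ p - 1) \<le> w (h - 1)"
      using assms that p_ge_2 unfolding best_gen_def by fastforce
    ultimately show False by simp
  qed
  obtain g where g: "g \<in> K" "g \<noteq> 0" "h * g ^ p - 1 \<in> \<M>"
    using normal_form_or_near_1[OF gen] no by blast
  have "h - 1 \<in> \<M>"
  proof (rule ccontr)
    assume "h - 1 \<notin> \<M>"
    then have "inverse (h - 1) \<in> \<O>" using not_M by blast
    then have "(h * g ^ p - 1) / (h - 1) \<in> \<M>" unfolding divide_inverse using g M_mult by blast
    then show False using max g by blast
  qed
  then show False using normal_form_or_improvable[OF gen] no gen max by blast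
qed

end

section \<open>The fundamental inequality and best approximation\<close>

context valued_subfield
begin

text \<open>By the ultrametric inequality the value of the sum is then the minimum over the terms
  with nonzero coefficient; stating only the upper bounds avoids forming a minimum.\<close>

definition val_indep where
  "val_indep I b \<longleftrightarrow> (\<forall>c. (\<forall>i\<in>I. c i \<in> K) \<longrightarrow> (\<forall>i\<in>I. c i \<noteq> 0 \<longrightarrow>
     (\<Sum>i\<in>I. c i * b i) \<noteq> 0 \<and> w (\<Sum>i\<in>I. c i * b i) \<le> w (c i * b i)))"

lemma val_indepD:
  assumes "val_indep I b" "\<And>i. i \<in> I \<Longrightarrow> c i \<in> K" "i \<in> I" "c i \<noteq> 0"
  shows "(\<Sum>i\<in>I. c i * b i) \<noteq> 0" "w (\<Sum>i\<in>I. c i * b i) \<le> w (c i * b i)"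
  using assms(1)[unfolded val_indep_def, rule_format, of c i] assms(2-4) by simp_all

lemma val_indep_imp_indep: "val_indep I b \<Longrightarrow> indep_fam I b"
  unfolding indep_fam_def
proof (intro allI impI ballI)
  fix c i assume "val_indep I b" "(\<forall>i\<in>I. c i \<in> K) \<and> (\<Sum>i\<in>I. c i * b i) = 0" "i \<in> I"
  then show "c i = 0" using val_indepD(1)[of I b c i] by auto
qed

lemma res_indep_not_M:
  assumes "finite F" "res_indep w K F" "y \<in> F"
  shows "y \<notin> \<M>"
proof
  assume "y \<in> \<M>"
  moreover have "(\<Sum>b\<in>F. (if b = y then 1 else 0) * b) = y"
    using assms by (simp add: if_distrib[of "\<lambda>c. c * _"] cong: if_cong)
  ultimately have "(if y = y then 1 else 0) \<in> max_ideal w K"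
    using assms(2,3) unfolding res_indep_def
    by (elim conjE allE[of _ "\<lambda>b. if b = y then 1 else 0"]) (auto simp: val_ring_K)
  then show False by (simp add: max_ideal_K)
qed

text \<open>Dividing by the coefficient of least value leaves integral coefficients, one of them
  equal to 1. Independence of the residues then makes the quotient \<open>T\<close> a unit, so the
  sum has the value of that coefficient.\<close>

lemma res_indep_sum:
  assumes F: "finite F" "res_indep w K F" and c: "\<And>y. y \<in> F \<Longrightarrow> c y \<in> K" and y: "y \<in> F" "c y \<noteq> 0"
  shows "(\<Sum>y\<in>F. c y * y) \<noteq> 0 \<and> w (\<Sum>y\<in>F. c y * y) \<le> w (c y) \<and>
    (\<exists>k\<in>K. k \<noteq> 0 \<and> w (\<Sum>y\<in>F. c y * y) = w k)"
proof -
  let ?N = "{y \<in> F. c y \<noteq> 0}"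
  have "finite ?N" "?N \<noteq> {}" using F(1) y by auto
  then obtain v where v: "v \<in> ?N" "\<not> (\<exists>u\<in>?N. w (c u) < w (c v))"
    using arg_min_if_finite[of ?N "\<lambda>y. w (c y)"] by blast
  define T where "T = (\<Sum>y\<in>F. c y / c v * y)"
  have quot: "c u / c v \<in> \<O>" "c u / c v \<in> K" if "u \<in> F" for u
  proof -
    show "c u / c v \<in> \<O>"
    proof (cases "c u = 0")
      case False
      then show ?thesis using v that w_le_iff[of "c v" "c u"] by auto
    qed simp
    show "c u / c v \<in> K" using c v(1) that by (auto intro: K_divide)
  qed
  have FO: "F \<subseteq> \<O>" using F(2) by (auto simp: res_indep_def)
  then have "T \<in> \<O>" unfolding T_def using quot by (intro O_sum O_mult) auto
  moreover have "T \<notin> \<M>"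
  proof
    assume "T \<in> \<M>"
    then have "c v / c v \<in> max_ideal w K"
      using F(2) quot v(1) unfolding res_indep_def T_def
      by (elim conjE allE[of _ "\<lambda>u. c u / c v"]) (auto simp: val_ring_K)
    then show False using v(1) by (simp add: max_ideal_K)
  qed
  moreover have "(\<Sum>y\<in>F. c y * y) = c v * T"
    using v(1) by (simp add: T_def sum_distrib_left)
  ultimately have "(\<Sum>y\<in>F. c y * y) \<noteq> 0" "w (\<Sum>y\<in>F. c y * y) = w (c v)"
    using v(1) U_iff[of T] by (auto simp: unit_O_def w_mult)
  then show ?thesis using v y c[of v] by auto
qed

definition val_coset where
  "val_coset x = (+) (w x) ` value_group w K"

lemma val_coset_eq:
  assumes "x \<noteq> 0" "y \<noteq> 0" "k \<in> K" "k \<noteq> 0" "l \<in> K" "l \<noteq> 0" "w (k * x) = w (l * y)"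
  shows "val_coset x = val_coset y"
proof -
  have sub: "val_coset x \<subseteq> val_coset y"
    if "x \<noteq> 0" "y \<noteq> 0" "k \<in> K" "k \<noteq> 0" "l \<in> K" "l \<noteq> 0" "w (k * x) = w (l * y)" for x y k l
  proof
    fix v assume "v \<in> val_coset x"
    then obtain m where m: "m \<in> K" "m \<noteq> 0" "v = w x + w m"
      by (auto simp: val_coset_def value_group_def)
    have "v = w y + w (l / k * m)"
      using that m by (simp add: w_mult w_divide algebra_simps)
    moreover have "l / k * m \<in> K - {0}" using that m by (auto intro: K_closed)
    ultimately show "v \<in> val_coset y"
      unfolding val_coset_def value_group_def by blast
  qed
  show ?thesis using sub[of x y k l] sub[of y x l k] assms by auto
qed

lemma val_coset_eqD:
  assumes "val_coset x = val_coset y" "x \<noteq> 0" "y \<noteq> 0"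
  shows "\<exists>k\<in>K. k \<noteq> 0 \<and> w x = w (k * y)"
proof -
  have "w x \<in> val_coset x"
    unfolding val_coset_def value_group_def
    by (rule image_eqI[of _ _ 0]) (auto intro: image_eqI[of _ _ 1])
  then show ?thesis using assms
    by (auto simp: val_coset_def value_group_def w_mult add.commute)
qed

text \<open>For fixed x the sum over \<open>F\<close> has its value in the value group of K. The
  terms \<open>x * T x\<close> thus lie in different cosets, so their values differ pairwise and
  \<open>w_sum_distinct\<close> applies.\<close>

lemma val_indep_products:
  assumes X: "finite X" "0 \<notin> X" "inj_on val_coset X" and F: "finite F" "res_indep w K F"
  shows "val_indep (X \<times> F) (\<lambda>(x, y). x * y)"
  unfolding val_indep_def
proof (intro allI impI ballI)
  fix c i assume c: "\<forall>i\<in>X \<times> F. c i \<in> K" and i: "i \<in> X \<times> F" "c i \<noteq> 0"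
  obtain u v where uv: "i = (u, v)" "u \<in> X" "v \<in> F" using i by auto
  define T where "T = (\<lambda>x. \<Sum>y\<in>F. c (x, y) * y)"
  \<comment> \<open>Terms whose coefficients all vanish are removed, since
    \<open>w_sum_distinct\<close> compares nonzero terms only.\<close>
  define N where "N = {x \<in> X. \<exists>y\<in>F. c (x, y) \<noteq> 0}"
  have T: "T x \<noteq> 0" "\<exists>k\<in>K. k \<noteq> 0 \<and> w (T x) = w k" if "x \<in> N" for x
    using that res_indep_sum[OF F, of "\<lambda>y. c (x, y)"] c by (auto simp: N_def T_def)
  have Tu: "w (T u) \<le> w (c i)"
    using res_indep_sum[OF F, of "\<lambda>y. c (u, y)" v] c uv i by (simp add: T_def)
  have uN: "u \<in> N" using uv i by (auto simp: N_def)
  have sum: "(\<Sum>i\<in>X \<times> F. c i * (case i of (x, y) \<Rightarrow> x * y)) = (\<Sum>x\<in>N. x * T x)"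
  proof -
    have "(\<Sum>i\<in>X \<times> F. c i * (case i of (x, y) \<Rightarrow> x * y)) = (\<Sum>x\<in>X. x * T x)"
      by (simp add: T_def sum.cartesian_product sum_distrib_left case_prod_beta mult_ac)
    also have "\<dots> = (\<Sum>x\<in>N. x * T x)"
      by (rule sum.mono_neutral_right) (use X in \<open>auto simp: N_def T_def\<close>)
    finally show ?thesis .
  qed
  have "(\<Sum>x\<in>N. x * T x) \<noteq> 0 \<and> w (\<Sum>x\<in>N. x * T x) \<le> w (u * T u)"
  proof (rule w_sum_distinct[OF _ _ _ uN])
    show "finite N" using X by (simp add: N_def)
    show "x * T x \<noteq> 0" if "x \<in> N" for x using T[OF that] that X by (auto simp: N_def)
    show "inj_on (\<lambda>x. w (x * T x)) N"
    proof (rule inj_onI)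
      fix x y assume xy: "x \<in> N" "y \<in> N" "w (x * T x) = w (y * T y)"
      then have xy0: "x \<in> X" "y \<in> X" "x \<noteq> 0" "y \<noteq> 0" using X by (auto simp: N_def)
      obtain k l where kl: "k \<in> K" "k \<noteq> 0" "w (T x) = w k" "l \<in> K" "l \<noteq> 0" "w (T y) = w l"
        using T(2) xy(1,2) by metis
      have "w (k * x) = w (l * y)"
        using xy(3) kl xy0 T(1) xy(1,2) by (simp add: w_mult add.commute)
      then have "val_coset x = val_coset y" using val_coset_eq kl xy0 by blast
      then show "x = y" using X(3) xy0 by (auto dest: inj_onD)
    qed
  qed
  moreover have "w (u * T u) \<le> w (c i * (u * v))"
  proof -
    have "v \<noteq> 0" using res_indep_not_M[OF F uv(3)] by auto
    moreover have "v \<in> \<O>" using F uv by (auto simp: res_indep_def)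
    ultimately have "0 \<le> w v" by (simp add: O_iff)
    moreover have "u \<noteq> 0" using X uv by auto
    ultimately show ?thesis using T(1)[OF uN] Tu i \<open>v \<noteq> 0\<close>
      by (simp add: w_mult) (metis add.commute add_increasing2 add_left_mono)
  qed
  ultimately show "(\<Sum>i\<in>X \<times> F. c i * (case i of (x, y) \<Rightarrow> x * y)) \<noteq> 0 \<and>
      w (\<Sum>i\<in>X \<times> F. c i * (case i of (x, y) \<Rightarrow> x * y)) \<le> w (c i * (case i of (x, y) \<Rightarrow> x * y))"
    unfolding sum using uv by auto
qed

text \<open>Some coordinate \<open>d\<^sub>j b\<^sub>j\<close> of \<open>1\<close> has value \<open>\<le> 0\<close>; choosing the constant that kills the
  \<open>j\<close>-th coordinate of \<open>v\<close> is optimal.\<close>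
lemma best_approximation:
  assumes B: "is_finite_basis K UNIV B" and I: "finite I" "card I = card B" "val_indep I b" and v: "v \<notin> K"
  shows "\<exists>a\<in>K. \<forall>a'\<in>K. w (v - a') \<le> w (v - a)"
proof -
  note span = spanning_family[OF B I(1,2) val_indep_imp_indep[OF I(3)]]
  obtain c where c: "\<And>i. i \<in> I \<Longrightarrow> c i \<in> K" "v = (\<Sum>i\<in>I. c i * b i)" using span by blast
  obtain d where d: "\<And>i. i \<in> I \<Longrightarrow> d i \<in> K" "1 = (\<Sum>i\<in>I. d i * b i)" using span by blast
  obtain j where j: "j \<in> I" "d j * b j \<notin> \<M>" using M_sum[of I "\<lambda>i. d i * b i"] d(2) by fastforce
  then have dj: "d j \<noteq> 0" "b j \<noteq> 0" "w (d j * b j) \<le> 0" by (auto simp: M_iff)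
  define a where "a = c j / d j"
  have aK: "a \<in> K" using c d j by (simp add: a_def K_closed)
  have "w (v - a') \<le> w (v - a)" if a': "a' \<in> K" for a'
  proof (cases "a' = a")
    case False
    have eq: "v - a' = (\<Sum>i\<in>I. (c i - a' * d i) * b i)"
    proof -
      have "v - a' = (\<Sum>i\<in>I. c i * b i) - a' * (\<Sum>i\<in>I. d i * b i)" using c(2) d(2) by simp
      then show ?thesis by (simp add: algebra_simps sum_subtractf sum_distrib_left)
    qed
    have cj: "c j - a' * d j = (a - a') * d j" using dj by (simp add: a_def field_simps)
    have "w (v - a') \<le> w ((c j - a' * d j) * b j)"
      unfolding eq using False dj c d a' j(1)
      by (intro val_indepD(2)[OF I(3)]) (auto simp: cj intro: K_closed)
    also have "\<dots> = w (a - a') + w (d j * b j)"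
      using False dj by (simp add: cj w_mult mult.assoc)
    also have "\<dots> \<le> w (a - a')" using dj by simp
    finally have le: "w (v - a') \<le> w (a - a')" .
    have ne: "v - a \<noteq> 0" "v - a' \<noteq> 0" using v aK a' by auto
    show ?thesis
    proof (rule ccontr)
      assume "\<not> ?thesis"
      \<comment> \<open>Then a - a' = (v - a') - (v - a) has the value of v - a, which contradicts
        the bound \<open>le\<close>.\<close>
      then have lt: "w (v - a) < w (v - a')" by simp
      then have "(v - a') / (v - a) \<in> \<M>" using ne by (simp add: w_less_iff)
      moreover have "(a - a') / (v - a) = (v - a') / (v - a) - 1" using ne by (simp add: field_simps)
      ultimately have "(a - a') / (v - a) \<in> \<U>"
        using U_cong[of "-1" "(a - a') / (v - a)"] by (simp add: U_minus)
      then have "w (v - a) = w (a - a')" using ne False by (simp add: w_eq_iff)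
      then show False using lt le by simp
    qed
  qed simp
  then show ?thesis using aK by blast
qed

end

context kummer_field
begin

section \<open>Ramification index and residue degree\<close>

lemma card_indep_le:
  assumes "finite I" "indep_fam I b"
  shows "card I \<le> p"
proof -
  obtain B where "is_finite_basis K UNIV B" "card B = p" using finite_basis_ex by blast
  then show ?thesis using dependent_family[of B I b] assms by force
qed

lemma fundamental_inequality:
  assumes "finite X" "0 \<notin> X" "inj_on val_coset X" "finite F" "res_indep w K F"
  shows "card X * card F \<le> p"
proof -
  have "card (X \<times> F) \<le> p"
    using assms by (intro card_indep_le[OF _ val_indep_imp_indep[OF val_indep_products]]) auto
  then show ?thesis by (simp add: card_cartesian_product)
qed

lemma res_indep_1: "res_indep w K {1}"
  unfolding res_indep_def by (simp add: val_ring_K max_ideal_K)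

lemma ram_index_eq: "ram_index w K = card (val_coset ` (UNIV - {0}))"
proof -
  have "{(+) g ` value_group w K |g. g \<in> value_group w UNIV} = val_coset ` (UNIV - {0})"
    by (auto simp: value_group_def val_coset_def)
  then show ?thesis by (simp add: ram_index_def)
qed

text \<open>\<open>ram_index\<close> is a cardinality, which would be 0 for an infinite set of
  cosets; finiteness makes it the true index.\<close>

lemma finite_val_cosets: "finite (val_coset ` (UNIV - {0}))"
proof (rule ccontr)
  assume "infinite (val_coset ` (UNIV - {0}))"
  then obtain T where T: "T \<subseteq> val_coset ` (UNIV - {0})" "finite T" "card T = Suc p"
    using infinite_arbitrarily_large[where n = "Suc p"] by blast
  then obtain X where X: "X \<subseteq> UNIV - {0}" "inj_on val_coset X" "T = val_coset ` X"
    using subset_image_inj[of T val_coset "UNIV - {0}"] by blast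
  then have "card X = Suc p" "finite X" using T by (auto simp: card_image finite_image_iff)
  then show False using fundamental_inequality[of X "{1}"] X res_indep_1 by auto
qed

lemma val_coset_representatives:
  "\<exists>X. finite X \<and> 0 \<notin> X \<and> inj_on val_coset X \<and> card X = ram_index w K"
proof -
  have "\<exists>X\<subseteq>UNIV - {0}. inj_on val_coset X \<and> val_coset ` (UNIV - {0}) = val_coset ` X"
    by (rule iffD1[OF subset_image_inj subset_refl])
  then obtain X where X: "X \<subseteq> UNIV - {0}" "inj_on val_coset X" "val_coset ` (UNIV - {0}) = val_coset ` X"
    by (elim exE conjE) (rule that)
  moreover have "finite X" using finite_val_cosets X by (simp add: finite_image_iff)
  ultimately show ?thesis by (intro exI[of _ X]) (auto simp: ram_index_eq card_image)
qed

lemma ram_index_ge: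
  assumes "finite X" "0 \<notin> X" "inj_on val_coset X"
  shows "card X \<le> ram_index w K"
proof -
  have "card X = card (val_coset ` X)" using assms by (simp add: card_image)
  also have "\<dots> \<le> ram_index w K"
    unfolding ram_index_eq using assms by (intro card_mono finite_val_cosets) auto
  finally show ?thesis .
qed

lemma res_card_le:
  assumes "finite F" "res_indep w K F"
  shows "card F \<le> p"
proof -
  have "card {1 :: 'a} * card F \<le> p"
    by (rule fundamental_inequality) (use assms in auto)
  then show ?thesis by simp
qed

lemma finite_res_cards: "finite {card F |F. finite F \<and> res_indep w K F}"
proof (rule finite_subset)
  show "{card F |F. finite F \<and> res_indep w K F} \<subseteq> {..p}"
    using res_card_le by auto
qed simp

lemma res_degree_ge: "finite F \<Longrightarrow> res_indep w K F \<Longrightarrow> card F \<le> res_degree w K"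
  unfolding res_degree_def 
  by (rule cSup_upper[OF _ bdd_above_finite[OF finite_res_cards]]) auto

lemma residue_representatives: "\<exists>F. finite F \<and> res_indep w K F \<and> card F = res_degree w K"
proof -
  let ?C = "{card F |F. finite F \<and> res_indep w K F}"
  have "card {1 :: 'a} \<in> ?C" using res_indep_1 by blast
  then have "?C \<noteq> {}" by blast
  then have "Max ?C \<in> ?C" using Max_in[OF finite_res_cards] by simp
  moreover have "Max ?C = res_degree w K" 
    using \<open>?C \<noteq> {}\<close> by (simp only: res_degree_def Sup_nat_def if_False)
  ultimately show ?thesis by auto
qed

lemma ef_le_p: "ram_index w K * res_degree w K \<le> p"
proof -
  obtain X where "finite X" "0 \<notin> X" "inj_on val_coset X" "card X = ram_index w K"
    using val_coset_representatives by blast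
  moreover obtain F where "finite F" "res_indep w K F" "card F = res_degree w K"
    using residue_representatives by blast
  ultimately show ?thesis using fundamental_inequality[of X F] by simp
qed

lemma defectless_iff: "defectless w K \<longleftrightarrow> ram_index w K * res_degree w K = p"
  using deg by (auto simp: defectless_def)

lemma defectless_of_cosets:
  assumes "finite X" "0 \<notin> X" "inj_on val_coset X" "card X = p"
  shows "defectless w K"
proof -
  have "p * 1 \<le> ram_index w K * res_degree w K"
    using ram_index_ge[OF assms(1-3)] res_degree_ge[of "{1}"] res_indep_1 assms(4)
    by (intro mult_le_mono) auto
  then show ?thesis using ef_le_p by (simp add: defectless_iff)
qed

lemma defectless_of_residues:
  assumes "finite F" "res_indep w K F" "card F = p"
  shows "defectless w K"
proof -
  have "1 * p \<le> ram_index w K * res_degree w K"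
    using ram_index_ge[of "{1}"] res_degree_ge[OF assms(1,2)] assms(3)
    by (intro mult_le_mono) auto
  then show ?thesis using ef_le_p by (simp add: defectless_iff)
qed

text \<open>The class of \<open>w x\<close> modulo the value group of K is nonzero and killed by the
  prime p, hence has order p; the powers of x with exponents below p represent p different
  cosets.\<close>

lemma defectless_of_value:
  assumes x: "x \<noteq> 0" "\<And>k. k \<in> K \<Longrightarrow> k \<noteq> 0 \<Longrightarrow> x / k \<notin> \<U>"
    and k0: "k0 \<in> K" "x ^ p / k0 \<in> \<U>"
  shows "defectless w K"
proof -
  have ndiv: "x ^ n / k \<notin> \<U>" if n: "0 < n" "n < p" and k: "k \<in> K" "k \<noteq> 0" for n k
  proof
    assume U: "x ^ n / k \<in> \<U>"
    obtain i m where im: "n * i = 1 + p * m" using inverse_mod_p[OF n] by blast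
    have "x ^ (n * i) = x * x ^ (p * m)" by (simp add: im)
    then have "(x ^ n / k) ^ i / (x ^ p / k0) ^ m = x / (k ^ i / k0 ^ m)"
      using x(1) by (simp add: power_divide flip: power_mult)
    moreover have "(x ^ n / k) ^ i / (x ^ p / k0) ^ m \<in> \<U>"
      by (intro U_divide U_power U k0(2))
    ultimately have "x / (k ^ i / k0 ^ m) \<in> \<U>" by (simp only:)
    moreover from this have "k ^ i / k0 ^ m \<noteq> 0" using U_not_0 by fastforce
    ultimately show False
      using x(2) K_divide[OF K_power[OF k(1)] K_power[OF k0(1)]] by blast
  qed
  have coset_neq: "val_coset (x ^ i) \<noteq> val_coset (x ^ j)" if "i < j" "j < p" for i j
  proof
    assume "val_coset (x ^ i) = val_coset (x ^ j)"
    then obtain k where k: "k \<in> K" "k \<noteq> 0" "w (x ^ i) = w (k * x ^ j)"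
      using val_coset_eqD[of "x ^ i" "x ^ j"] x(1) by auto
    then have "k * x ^ j / x ^ i \<in> \<U>" using x(1) by (subst (asm) w_eq_iff) auto
    moreover have "k * x ^ j / x ^ i = x ^ (j - i) / inverse k"
      using that x(1) by (simp add: power_diff field_simps)
    ultimately show False using ndiv[of "j - i" "inverse k"] that k K_inverse by auto
  qed
  then have inj: "inj_on (\<lambda>i. val_coset (x ^ i)) {..<p}"
    by (intro linorder_inj_onI') auto
  define X where "X = (\<lambda>i. x ^ i) ` {..<p}"
  have "inj_on (\<lambda>i. x ^ i) {..<p}" using inj by (auto simp: inj_on_def)
  then have "card X = p" by (simp add: X_def card_image)
  moreover have "inj_on val_coset X" using inj by (auto simp: X_def inj_on_def)
  ultimately show ?thesis using x(1) by (intro defectless_of_cosets[of X]) (auto simp: X_def)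
qed

section \<open>From a defectless extension to a normal form\<close>

lemma defectless_best_approximation:
  assumes "defectless w K" "v \<notin> K"
  shows "\<exists>a\<in>K. \<forall>a'\<in>K. w (v - a') \<le> w (v - a)"
proof -
  obtain X where X: "finite X" "0 \<notin> X" "inj_on val_coset X" "card X = ram_index w K"
    using val_coset_representatives by blast
  obtain F where F: "finite F" "res_indep w K F" "card F = res_degree w K"
    using residue_representatives by blast
  obtain B where B: "is_finite_basis K UNIV B" "card B = p" using finite_basis_ex by blast
  have "card (X \<times> F) = card B"
    using X F B assms by (simp add: card_cartesian_product defectless_iff)
  then show ?thesis
    using best_approximation[OF B(1) _ _ val_indep_products assms(2)] X F by blast
qed

lemma defectless_imp_normal_form:
  assumes dl: "defectless w K" and h: "generates K p h"
  shows "\<exists>h. generates K p h \<and> normal_form h"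
proof (rule ccontr)
  assume no: "\<not> ?thesis"
  then obtain g where g: "g \<in> K" "g \<noteq> 0" "h * g ^ p - 1 \<in> \<M>"
    using normal_form_or_near_1[OF h] by blast
  obtain \<alpha> where \<alpha>: "\<alpha> ^ p = h * g ^ p" "gen_field K \<alpha> = UNIV"
    using generates_mult_power[OF h g(1,2)] by (auto simp: generates_def)
  have \<alpha>K: "\<alpha> \<notin> K" using generator_notin_K \<alpha> by blast
  obtain a where a: "a \<in> K" "\<And>a'. a' \<in> K \<Longrightarrow> w (\<alpha> - a') \<le> w (\<alpha> - a)"
    using defectless_best_approximation[OF dl \<alpha>K] by blast
  have \<alpha>1: "\<alpha> - 1 \<in> \<M>" using power_p_near_1[of \<alpha>] \<alpha> g by simp
  moreover have "\<alpha> - 1 \<noteq> 0" "\<alpha> - a \<noteq> 0" using \<alpha>K a(1) K_1 by (metis eq_iff_diff_eq_0)+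
  \<comment> \<open>The approximation 1 already has positive distance value, and a is at least as
    good.\<close>
  ultimately have \<alpha>a: "\<alpha> - a \<in> \<M>" using a(2)[of 1] by (auto simp: M_iff)
  have "a - 1 \<in> \<M>" using M_diff[OF \<alpha>1 \<alpha>a] by simp
  then have aU: "a \<in> \<U>" using U_cong[of 1 a] by simp
  note a0 = U_not_0[OF aU]
  define \<beta> where "\<beta> = \<alpha> / a"
  have \<beta>K: "\<beta> \<notin> K" using \<alpha>K a(1) a0 K_mult[of \<beta> a] by (auto simp: \<beta>_def)
  have best: "w (\<beta> - a') \<le> w (\<beta> - 1)" if "a' \<in> K" for a'
  proof -
    have "\<beta> - a' = (\<alpha> - a' * a) / a" "\<beta> - 1 = (\<alpha> - a) / a" using a0 by (simp_all add: \<beta>_def field_simps)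
    moreover have "\<alpha> - a' * a \<noteq> 0" "\<alpha> - a \<noteq> 0" using \<alpha>K a(1) that by (metis K_mult eq_iff_diff_eq_0)+
    ultimately show ?thesis using a that a0 by (simp add: w_divide K_mult)
  qed
  define h1 where "h1 = \<beta> ^ p"
  have h1_eq: "h1 = h * (g / a) ^ p" by (simp add: h1_def \<beta>_def power_divide \<alpha>)
  have h1: "generates K p h1"
    unfolding h1_eq using g a a0 by (intro generates_mult_power[OF h]) (auto intro: K_closed)
  define b where "b = \<beta> - 1"
  have "b = (\<alpha> - a) * inverse a" using a0 by (simp add: b_def \<beta>_def field_simps)
  also have "\<dots> \<in> \<M>" using \<alpha>a aU by (intro M_mult U_O U_inverse)
  finally have b: "b \<in> \<M>" .
  have b0: "b \<noteq> 0" using \<beta>K K_1 by (auto simp: b_def)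
  have "h1 = (1 + b) ^ p" by (simp add: h1_def b_def)
  have near: "h1 - 1 \<in> \<M>"
    using one_M_power[OF b O_1, of p] \<open>h1 = (1 + b) ^ p\<close> by auto
  obtain c where zh: "z ^ p / (h1 - 1) \<in> \<M>" and c: "c \<in> K" "c \<noteq> 0" "(h1 * c ^ p - 1) / (h1 - 1) \<in> \<M>"
    using normal_form_or_improvable[OF h1 near] no h1 by blast
  have h1n: "h1 - 1 \<noteq> 0" using generates_not_1[OF h1] by simp
  \<comment> \<open>If b were at or beyond the threshold, \<open>power_p_large\<close> would make
    \<open>(h1 - 1) / z ^ p\<close> integral, but h1 - 1 lies strictly below
    \<open>z ^ p\<close>.\<close>
  have zb: "z / b \<in> \<M>"
  proof (rule ccontr)
    assume "z / b \<notin> \<M>"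
    then have "inverse (z / b) \<in> \<O>" using not_M by blast
    then have d: "b / z \<in> \<O>" by simp
    define q where "q = (h1 - 1) / z ^ p"
    have "q - ((b / z) ^ p - b / z) \<in> \<M>"
      using power_p_large[OF d] z_not_0 \<open>h1 = (1 + b) ^ p\<close> by (simp add: q_def)
    moreover have "(b / z) ^ p - b / z \<in> \<O>" using d by (intro O_diff O_power)
    ultimately have "q \<in> \<O>"
      using O_add[OF M_sub_O, of "q - ((b / z) ^ p - b / z)" "(b / z) ^ p - b / z"] by simp
    moreover have "inverse q \<in> \<M>" using zh by (simp add: q_def)
    ultimately show False using inverse_O[of q] h1n z_not_0 by (simp add: q_def)
  qed
  define X where "X = (h1 - 1) / b ^ p"
  have XU: "X \<in> \<U>"
    using power_p_small[OF b b0 zb] \<open>h1 = (1 + b) ^ p\<close> U_cong[of 1 X] by (simp add: X_def)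
  \<comment> \<open>\<open>\<beta> * c\<close> is the root of the improved generator
    \<open>h1 * c ^ p\<close>, and y is its distance from 1.\<close>
  define y where "y = \<beta> * c - 1"
  have y0: "y \<noteq> 0"
  proof
    assume "y = 0"
    then have "\<beta> = inverse c" using c by (simp add: y_def field_simps)
    then show False using \<beta>K c K_inverse by blast
  qed
  have hy: "h1 * c ^ p = (1 + y) ^ p" by (simp add: y_def h1_def power_mult_distrib)
  have "(h1 * c ^ p - 1) / (h1 - 1) * (h1 - 1) \<in> \<M>" using c near by (intro M_mult M_sub_O[of "h1 - 1"])
  then have h1c: "h1 * c ^ p - 1 \<in> \<M>" using h1n by simp
  then have yM: "y \<in> \<M>" using power_p_near_1[of "1 + y"] by (simp add: hy)
  \<comment> \<open>Below the threshold the p-th power of a root's distance from 1 agrees, up to a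
    unit, with the distance of the generator from 1, so the improvement passes to the roots. If y is
    not below the threshold, it suffices that b is.\<close>
  have yb: "y / b \<in> \<M>"
  proof (cases "z / y \<in> \<M>")
    case True
    define Y where "Y = ((1 + y) ^ p - 1) / y ^ p"
    have YU: "Y \<in> \<U>" using power_p_small[OF yM y0 True] U_cong[of 1 Y] by (simp add: Y_def)
    define N D where "N = h1 * c ^ p - 1" and "D = h1 - 1"
    have ND: "X = D / b ^ p" "Y = N / y ^ p" "D \<noteq> 0" "N \<noteq> 0"
      using h1n U_not_0[OF YU] by (auto simp: X_def Y_def N_def D_def hy)
    have "(y / b) ^ p = N / D * (X / Y)"
      using y0 b0 ND(3,4) by (simp add: ND(1,2) power_divide)
    also have "\<dots> = (h1 * c ^ p - 1) / (h1 - 1) * (X / Y)" by (simp add: N_def D_def)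
    also have "\<dots> \<in> \<M>" using c XU YU by (intro M_mult U_O[OF U_divide])
    finally show ?thesis using M_power_iff[OF p_pos] by blast
  next
    case False
    then have "inverse (z / y) \<in> \<O>" using not_M by blast
    then have "z / b * (y / z) \<in> \<M>" using zb by (intro M_mult) auto
    then show ?thesis using z_not_0 by simp
  qed
  have cU: "c \<in> \<U>"
  proof -
    have "h1 * c ^ p \<in> \<U>" "h1 \<in> \<U>" using U_cong[OF U_1] h1c near by blast+
    then have "h1 * c ^ p / h1 \<in> \<U>" by (rule U_divide)
    then have "c ^ p \<in> \<U>" using generates_not_0[OF h1] by simp
    then show ?thesis using U_power_iff[OF p_pos] by blast
  qed
  \<comment> \<open>As c is a unit, \<open>inverse c\<close> approximates \<beta> as well as 1
    approximates \<open>\<beta> * c\<close>, which is better than 1 approximates \<beta>.\<close>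
  have "\<beta> - inverse c = y / c" using c by (simp add: y_def field_simps)
  then have "w (\<beta> - inverse c) = w y" using c y0 cU by (simp add: w_divide U_iff)
  moreover have "w (\<beta> - inverse c) \<le> w b" using best[of "inverse c"] c by (simp add: b_def K_closed)
  moreover have "w b < w y" using yb b0 y0 by (simp add: w_less_iff)
  ultimately show False by simp
qed

end

section \<open>Polynomials modulo the maximal ideal\<close>

definition poly_in :: "'a::field set \<Rightarrow> 'a poly \<Rightarrow> bool" where
  "poly_in R f \<longleftrightarrow> (\<forall>i. coeff f i \<in> R)"

lemma poly_in_mult:
  assumes "poly_in R f" "poly_in S g" "0 \<in> T"
    and "\<And>x y. x \<in> R \<Longrightarrow> y \<in> S \<Longrightarrow> x * y \<in> T" "\<And>x y. x \<in> T \<Longrightarrow> y \<in> T \<Longrightarrow> x + y \<in> T"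
  shows "poly_in T (f * g)"
proof -
  have "sum c I \<in> T" if "\<And>i. i \<in> I \<Longrightarrow> c i \<in> T" for c and I :: "nat set"
    using that assms(3,5) by (induction I rule: infinite_finite_induct) auto
  then show ?thesis using assms(1,2,4) by (simp add: poly_in_def coeff_mult)
qed

text \<open>A monic divisor never requires inverses of coefficients, so division stays inside a ring
  such as \<O> or \<open>K \<inter> \<O>\<close>. Bounding the remainder by vanishing coefficients
  spares a special case for the zero polynomial.\<close>

lemma monic_division:
  assumes R: "0 \<in> R" "\<And>x y. x \<in> R \<Longrightarrow> y \<in> R \<Longrightarrow> x * y \<in> R" "\<And>x y. x \<in> R \<Longrightarrow> y \<in> R \<Longrightarrow> x + y \<in> R"
      "\<And>x. x \<in> R \<Longrightarrow> - x \<in> R"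
    and g: "poly_in R g" "lead_coeff g = 1" and f: "poly_in R f"
  shows "\<exists>q r. poly_in R q \<and> poly_in R r \<and> f = q * g + r \<and> (\<forall>i\<ge>degree g. coeff r i = 0)"
proof -
  have "\<exists>q r. poly_in R q \<and> poly_in R r \<and> f = q * g + r \<and> (\<forall>i\<ge>degree g. coeff r i = 0)"
    if "poly_in R f" "\<forall>i\<ge>n. coeff f i = 0" for n f
    using that
  proof (induction n arbitrary: f)
    case 0
    then show ?case using R by (intro exI[of _ 0] exI[of _ f]) (auto simp: poly_in_def)
  next
    case (Suc n)
    show ?case
    proof (cases "Suc n \<le> degree g")
      case True
      then show ?thesis using Suc R by (intro exI[of _ 0] exI[of _ f]) (auto simp: poly_in_def)
    next
      case False
      define m where "m = monom (coeff f n) (n - degree g)"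
      have m: "poly_in R m" using Suc.prems R by (auto simp: poly_in_def m_def)
      have mg: "poly_in R (m * g)" by (rule poly_in_mult[OF m g(1)]) (use R in auto)
      have "coeff (f - m * g) i = 0" if "i \<ge> n" for i
        using that False Suc.prems(2) g(2)
        by (cases "i = n") (auto simp: m_def coeff_monom_mult coeff_eq_0)
      moreover have "poly_in R (f - m * g)"
        unfolding poly_in_def
      proof
        fix i
        have "coeff f i + - coeff (m * g) i \<in> R"
          using Suc.prems(1) mg R unfolding poly_in_def by blast
        then show "coeff (f - m * g) i \<in> R" by simp
      qed
      ultimately obtain q r where "poly_in R q" "poly_in R r" "f - m * g = q * g + r"
        "\<forall>i\<ge>degree g. coeff r i = 0"
        using Suc.IH[of "f - m * g"] by blast
      moreover have "poly_in R (m + q)" using m \<open>poly_in R q\<close> R by (simp add: poly_in_def)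
      ultimately show ?thesis
        by (intro exI[of _ "m + q"] exI[of _ r]) (simp add: algebra_simps)
    qed
  qed
  from this[of f "Suc (degree f)"] show ?thesis using f by (simp add: coeff_eq_0)
qed

lemma monic_prod_linear:
  fixes \<beta> :: "'i \<Rightarrow> 'a::field"
  assumes "finite J"
  shows "degree (\<Prod>j\<in>J. [:- \<beta> j, 1:]) = card J" "lead_coeff (\<Prod>j\<in>J. [:- \<beta> j, 1:]) = 1"
  by (subst degree_prod_sum_eq) (auto simp: lead_coeff_prod)

text \<open>Vieta's formula for the coefficient just below the leading one.\<close>

lemma coeff_prod_linear:
  fixes \<beta> :: "'i \<Rightarrow> 'a::field"
  assumes "finite S" "card S = Suc n"
  shows "coeff (\<Prod>j\<in>S. [:- \<beta> j, 1:]) n = - (\<Sum>j\<in>S. \<beta> j)"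
  using assms
proof (induction S arbitrary: n rule: finite_induct)
  case (insert j S)
  then have n: "n = card S" by simp
  have 1: "coeff (\<Prod>j\<in>S. [:- \<beta> j, 1:]) n = 1"
    using monic_prod_linear[OF insert.hyps(1), of \<beta>] n by simp
  show ?case
  proof (cases n)
    case 0
    then show ?thesis using insert n by simp
  next
    case (Suc m)
    then show ?thesis using insert.IH[of m] insert.hyps n 1 by simp
  qed
qed simp

context valued_field
begin

lemma poly_M:
  assumes "poly_in \<M> f" "x \<in> \<O>"
  shows "poly f x \<in> \<M>"
  unfolding poly_altdef using assms by (intro M_sum M_mult O_power) (auto simp: poly_in_def)

lemma poly_O:
  assumes "poly_in \<O> f" "x \<in> \<O>"
  shows "poly f x \<in> \<O>"
  unfolding poly_altdef using assms by (intro O_sum O_mult O_power) (auto simp: poly_in_def)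

lemma poly_in_M_add: "poly_in \<M> f \<Longrightarrow> poly_in \<M> g \<Longrightarrow> poly_in \<M> (f + g)"
  and poly_in_M_diff: "poly_in \<M> f \<Longrightarrow> poly_in \<M> g \<Longrightarrow> poly_in \<M> (f - g)"
  by (auto simp: poly_in_def M_add M_diff)

lemma poly_in_M_mult: "poly_in \<M> f \<Longrightarrow> poly_in \<O> g \<Longrightarrow> poly_in \<M> (f * g)"
  by (rule poly_in_mult) (auto intro: M_mult M_add)

lemma poly_in_O_mult: "poly_in \<O> f \<Longrightarrow> poly_in \<O> g \<Longrightarrow> poly_in \<O> (f * g)"
  by (rule poly_in_mult) (auto intro: O_mult O_add)

lemma poly_in_O_linear: "\<beta> \<in> \<O> \<Longrightarrow> poly_in \<O> [:- \<beta>, 1:]"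
  by (auto simp: poly_in_def coeff_pCons O_minus split: nat.split)

lemma poly_in_O_prod_linear:
  "(\<And>j. j \<in> J \<Longrightarrow> \<beta> j \<in> \<O>) \<Longrightarrow> poly_in \<O> (\<Prod>j\<in>J. [:- \<beta> j, 1:])"
proof (induction J rule: infinite_finite_induct)
  case (insert j J)
  then show ?case unfolding prod.insert[OF insert.hyps]
    by (intro poly_in_O_mult poly_in_O_linear) auto
qed (auto simp: poly_in_def)

text \<open>The highest coefficient of P outside \<M> would reappear, modulo \<M>, in the product
  one degree higher.\<close>

lemma cancel_linear_M:
  assumes "poly_in \<M> (P * [:- \<beta>, 1:])" "\<beta> \<in> \<O>"
  shows "poly_in \<M> P"
proof (rule ccontr)
  assume "\<not> poly_in \<M> P"
  let ?N = "{n. coeff P n \<notin> \<M>}"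
  have "?N \<subseteq> {..degree P}" by (auto intro: le_degree)
  then have fin: "finite ?N" by (rule finite_subset) simp
  moreover have "?N \<noteq> {}" using \<open>\<not> poly_in \<M> P\<close> by (auto simp: poly_in_def)
  ultimately have m: "Max ?N \<in> ?N" by (rule Max_in)
  define m where "m = Max ?N"
  have "coeff P (Suc m) \<in> \<M>" using Max_ge[OF fin, of "Suc m"] by (auto simp: m_def)
  then have "\<beta> * coeff P (Suc m) \<in> \<M>" using assms(2) by (intro M_mult')
  moreover have "coeff (P * [:- \<beta>, 1:]) (Suc m) \<in> \<M>"
    using assms(1) unfolding poly_in_def by blast
  ultimately have "coeff (P * [:- \<beta>, 1:]) (Suc m) + \<beta> * coeff P (Suc m) \<in> \<M>" using M_add by blast
  then have "coeff P m \<in> \<M>" by (simp add: algebra_simps)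
  then show False using m by (simp add: m_def)
qed

text \<open>Division by X - \<beta> leaves the constant remainder f(\<beta>), which vanishes modulo
  \<M>.\<close>

lemma monic_root_divides:
  assumes f: "poly_in \<O> f" "lead_coeff f = 1" and \<beta>: "\<beta> \<in> \<O>" "poly f \<beta> \<in> \<M>"
  shows "\<exists>f1 r. f = f1 * [:- \<beta>, 1:] + r \<and> poly_in \<O> f1 \<and> lead_coeff f1 = 1 \<and> poly_in \<M> r \<and>
    degree f = Suc (degree f1)"
proof -
  let ?g = "[:- \<beta>, 1:]"
  have "degree f \<noteq> 0"
  proof
    assume "degree f = 0"
    then have "f = 1" using f(2) by (auto elim: degree_eq_zeroE)
    then show False using \<beta> by simp
  qed
  obtain f1 r where r: "poly_in \<O> f1" "poly_in \<O> r" "f = f1 * ?g + r" "\<forall>i\<ge>degree ?g. coeff r i = 0"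
    using monic_division[of \<O> ?g f] f \<beta> poly_in_O_linear
    by (auto simp: O_add O_mult O_minus)
  have r0: "r = [:coeff r 0:]"
    using r(4) by (intro poly_eqI) (auto simp: coeff_pCons split: nat.split)
  then have "poly r \<beta> = coeff r 0" by (metis poly_0_coeff_0 poly_pCons poly_0 mult_zero_right)
  moreover have "poly f \<beta> = poly r \<beta>" by (simp add: r(3))
  ultimately have "coeff r 0 \<in> \<M>" using \<beta> by simp
  then have rM: "poly_in \<M> r" by (subst r0) (auto simp: poly_in_def coeff_pCons split: nat.split)
  have "degree r = 0" using r0 degree_pCons_0 by metis
  then have dr: "degree (- r) < degree f" using \<open>degree f \<noteq> 0\<close> by simp
  have f1g: "f1 * ?g = f + - r" using r(3) by simp
  have deg: "degree (f1 * ?g) = degree f" unfolding f1g using dr by (rule degree_add_eq_left)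
  have "lead_coeff (f1 * ?g) = 1"
    using deg dr f(2) unfolding f1g by (simp add: coeff_eq_0)
  then have lc: "lead_coeff f1 = 1" unfolding lead_coeff_mult by simp
  then have "f1 \<noteq> 0" by auto
  then have "degree (f1 * ?g) = degree f1 + degree ?g" by (intro degree_mult_eq) auto
  then have "degree f = Suc (degree f1)" unfolding deg by simp
  then show ?thesis using r rM lc by blast
qed

text \<open>Unique factorisation modulo \<open>\<M>\<close>, without constructing the residue field.\<close>
lemma monic_factor_of_linear_product:
  assumes "finite J" "\<And>j. j \<in> J \<Longrightarrow> \<beta> j \<in> \<O>"
    and "poly_in \<O> f" "lead_coeff f = 1" "poly_in \<O> q" "lead_coeff q = 1"
    and "poly_in \<M> (f * q - (\<Prod>j\<in>J. [:- \<beta> j, 1:]))"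
  shows "\<exists>S\<subseteq>J. card S = degree f \<and> poly_in \<M> (f - (\<Prod>j\<in>S. [:- \<beta> j, 1:]))"
  using assms
proof (induction J arbitrary: f q rule: finite_induct)
  case empty
  have "degree (f * q) = 0"
  proof (rule ccontr)
    assume "degree (f * q) \<noteq> 0"
    moreover have "coeff (f * q - 1) (degree (f * q)) \<in> \<M>"
      using empty by (auto simp: poly_in_def)
    moreover have "lead_coeff (f * q) = 1"
      using empty by (simp only: lead_coeff_mult mult_1)
    ultimately show False by simp
  qed
  moreover have "f \<noteq> 0" "q \<noteq> 0" using empty by auto
  ultimately have "degree f = 0" by (simp add: degree_mult_eq)
  moreover from this have "f = 1" using empty.prems(3) by (auto elim: degree_eq_zeroE)
  ultimately show ?case by (auto simp: poly_in_def)
next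
  case (insert j J)
  let ?g = "[:- \<beta> j, 1:]" and ?P = "\<Prod>j\<in>J. [:- \<beta> j, 1:]"
  have \<beta>: "\<beta> j \<in> \<O>" "\<And>i. i \<in> J \<Longrightarrow> \<beta> i \<in> \<O>" using insert.prems(1) by auto
  have prod: "(\<Prod>j\<in>insert j J. [:- \<beta> j, 1:]) = ?g * ?P" using insert.hyps by simp
  have D: "poly_in \<M> (f * q - ?g * ?P)" using insert.prems(6) unfolding prod .
  have "poly (f * q - ?g * ?P) (\<beta> j) = poly f (\<beta> j) * poly q (\<beta> j)" by simp
  then have "poly f (\<beta> j) * poly q (\<beta> j) \<in> \<M>" using poly_M[OF D \<beta>(1)] by simp
  \<comment> \<open>\<M> is prime, so \<open>\<beta> j\<close> is a root modulo \<M> of one of the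
    two factors. That factor gives up X - \<open>\<beta> j\<close>, and j joins S only if the factor
    is f.\<close>
  then consider "poly f (\<beta> j) \<in> \<M>" | "poly q (\<beta> j) \<in> \<M>" using M_prime by blast
  then show ?case
  proof cases
    case 1
    obtain f1 r where r: "f = f1 * ?g + r" "poly_in \<O> f1" "lead_coeff f1 = 1" "poly_in \<M> r"
      "degree f = Suc (degree f1)"
      using monic_root_divides[OF insert.prems(2,3) \<beta>(1) 1] by blast
    have "(f1 * q - ?P) * ?g = (f * q - ?g * ?P) - r * q"
      unfolding r(1) by (simp only: algebra_simps)
    then have "poly_in \<M> ((f1 * q - ?P) * ?g)"
      using D r(4) insert.prems(4) poly_in_M_mult poly_in_M_diff by metis
    then have "poly_in \<M> (f1 * q - ?P)" using cancel_linear_M \<beta>(1) by blast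
    then obtain S where S: "S \<subseteq> J" "card S = degree f1" "poly_in \<M> (f1 - (\<Prod>j\<in>S. [:- \<beta> j, 1:]))"
      using insert.IH[OF \<beta>(2) r(2,3) insert.prems(4,5)] by blast
    have fin: "finite S" "j \<notin> S" using S insert.hyps by (auto intro: finite_subset)
    have "f - (\<Prod>j\<in>insert j S. [:- \<beta> j, 1:]) = (f1 - (\<Prod>j\<in>S. [:- \<beta> j, 1:])) * ?g + r"
      unfolding prod.insert[OF fin] r(1) by (simp only: algebra_simps)
    moreover have "poly_in \<M> \<dots>"
      using S r(4) \<beta> by (intro poly_in_M_add poly_in_M_mult poly_in_O_linear)
    ultimately show ?thesis using S fin r(5) by (intro exI[of _ "insert j S"]) auto
  next
    case 2
    obtain q1 r where r: "q = q1 * ?g + r" "poly_in \<O> q1" "lead_coeff q1 = 1" "poly_in \<M> r"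
      using monic_root_divides[OF insert.prems(4,5) \<beta>(1) 2] by blast
    have "(f * q1 - ?P) * ?g = (f * q - ?g * ?P) - r * f"
      unfolding r(1) by (simp only: algebra_simps)
    then have "poly_in \<M> ((f * q1 - ?P) * ?g)"
      using D r(4) insert.prems(2) poly_in_M_mult poly_in_M_diff by metis
    then have "poly_in \<M> (f * q1 - ?P)" using cancel_linear_M \<beta>(1) by blast
    then show ?thesis
      using insert.IH[OF \<beta>(2) insert.prems(2,3) r(2,3)] by blast
  qed
qed

end

section \<open>Normal forms and the defect\<close>

context kummer_field
begin

section \<open>Residue extensions of degree p\<close>

lemma zeta_O: "\<zeta> \<in> \<O>"
  using O_add[OF O_1 M_sub_O[OF z_M]] by (simp add: z_def)

lemma zeta_power: "\<exists>t\<in>K. t \<in> \<O> \<and> \<zeta> ^ j = 1 + z * t"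
proof (intro bexI conjI)
  show "\<zeta> ^ j = 1 + z * (\<Sum>i<j. \<zeta> ^ i)"
    using power_diff_1_eq[of \<zeta> j] by (simp add: z_def algebra_simps)
qed (auto intro!: O_sum O_power zeta_O K_sum K_power zeta)

lemma power_p_cong:
  assumes "x \<in> \<O>" "y \<in> \<O>" "x - y \<in> \<M>"
  shows "x ^ p - y ^ p \<in> \<M>"
  using M_cong[OF frobenius_diff[OF assms(1,2)]] M_power[OF assms(3) p_pos] by simp

lemma poly_in_K_power: "poly_in K f \<Longrightarrow> poly_in K (f ^ n)"
proof (induction n)
  case (Suc n)
  then have "poly_in K (f * f ^ n)" by (intro poly_in_mult[of K _ K]) (auto intro: K_closed)
  then show ?case by simp
qed (simp add: poly_in_def)

text \<open>If the residue of \<open>\<beta>\<close> had degree \<open>d < p\<close> over \<open>k\<close>, its minimal polynomial would modulo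
  \<open>\<M>\<close> be a product of \<open>d\<close> of the factors \<open>X - \<beta>\<^sub>j\<close>. As \<open>\<beta>\<^sub>j - \<beta>\<close> is congruent to an
  element of \<open>K\<close>, its second coefficient puts \<open>d \<beta>\<close>, hence \<open>\<beta>\<close>, into \<open>K + \<M>\<close>.\<close>
lemma power_basis_residues:
  assumes \<alpha>: "\<alpha> ^ p = h" "h \<in> K" and as: "a \<in> K" "s \<in> K" "s \<noteq> 0" "a * z / s \<in> \<O>"
    and \<beta>: "\<beta> = (\<alpha> - a) / s" "\<beta> \<in> \<O>" and nres: "\<And>b. b \<in> K \<Longrightarrow> b \<in> \<O> \<Longrightarrow> \<beta> - b \<notin> \<M>"
    and f: "poly_in (K \<inter> \<O>) f" "poly f \<beta> \<in> \<M>" "degree f < p"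
  shows "poly_in \<M> f"
proof (rule ccontr)
  assume "\<not> poly_in \<M> f"
  let ?R = "K \<inter> \<O>"
  have RO: "poly_in \<O> g" if "poly_in ?R g" for g using that by (auto simp: poly_in_def)
  define bad where "bad = (\<lambda>g. poly_in ?R g \<and> poly g \<beta> \<in> \<M> \<and> \<not> poly_in \<M> g)"
  have "bad f" using f \<open>\<not> poly_in \<M> f\<close> by (simp add: bad_def)
  \<comment> \<open>A substitute for the minimal polynomial of the residue of \<beta>. Minimality
    yields \<open>small\<close>, and also makes the leading coefficient a unit: otherwise dropping
    the leading term would leave a smaller counterexample.\<close>
  then obtain g where g: "bad g" "\<And>g'. bad g' \<Longrightarrow> degree g \<le> degree g'"
    using ex_has_least_nat[of bad f degree] by blast
  define d where "d = degree g"
  have "d < p" using g(2)[OF \<open>bad f\<close>] f by (simp add: d_def)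
  have small: "poly_in \<M> r" if r: "poly_in ?R r" "poly r \<beta> \<in> \<M>" "\<forall>i\<ge>d. coeff r i = 0" for r
  proof (rule ccontr)
    assume "\<not> poly_in \<M> r"
    then have "d \<le> degree r" using r g(2)[of r] by (simp add: bad_def d_def)
    then have "r = 0" using r(3) by auto
    then show False using \<open>\<not> poly_in \<M> r\<close> by (simp add: poly_in_def)
  qed
  have gR: "poly_in ?R g" "poly g \<beta> \<in> \<M>" "\<not> poly_in \<M> g" using g(1) by (auto simp: bad_def)
  define c where "c = lead_coeff g"
  have cR: "c \<in> K" "c \<in> \<O>" using gR(1) by (auto simp: c_def poly_in_def)
  have "c \<notin> \<M>"
  proof
    assume cM: "c \<in> \<M>"
    define g' where "g' = g - monom c d"
    have "poly_in ?R g'" using gR(1) cR by (auto simp: g'_def poly_in_def intro: K_diff O_diff)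
    moreover have "poly g' \<beta> \<in> \<M>"
      using gR(2) cM \<beta>(2) by (auto simp: g'_def poly_monom intro!: M_diff M_mult O_power)
    moreover have "\<forall>i\<ge>d. coeff g' i = 0"
      by (auto simp: g'_def c_def d_def coeff_eq_0)
    ultimately have "poly_in \<M> g'" by (rule small)
    moreover have "poly_in \<M> (monom c d)" using cM by (simp add: poly_in_def)
    ultimately have "poly_in \<M> (g' + monom c d)" by (rule poly_in_M_add)
    then show False using gR(3) by (simp add: g'_def)
  qed
  then have cU: "c \<in> \<U>" using cR by (simp add: unit_O_def)
  have ic: "inverse c \<in> K" "inverse c \<in> \<O>" "c \<noteq> 0"
    using K_inverse cR U_O[OF U_inverse[OF cU]] U_not_0[OF cU] by auto
  define f1 where "f1 = smult (inverse c) g"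
  have f1: "poly_in ?R f1" "poly f1 \<beta> \<in> \<M>" "degree f1 = d" "lead_coeff f1 = 1"
    using gR ic by (auto simp: f1_def d_def c_def poly_in_def intro: K_mult O_mult M_mult')
  have "d \<noteq> 0"
  proof
    assume "d = 0"
    then have "f1 = 1" using f1(3,4) by (auto elim: degree_eq_zeroE)
    then show False using f1(2) by simp
  qed
  obtain t where t: "\<And>j. t j \<in> K" "\<And>j. t j \<in> \<O>" "\<And>j. \<zeta> ^ j = 1 + z * t j"
    using zeta_power by metis
  define \<beta>' where "\<beta>' = (\<lambda>j::nat. (\<zeta> ^ j * \<alpha> - a) / s)"
  \<comment> \<open>Substituting \<open>\<alpha> = s * \<beta> + a\<close> in
    \<open>(\<zeta> ^ j - 1) * \<alpha> / s\<close> gives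
    \<open>\<kappa> j + z * t j * \<beta>\<close>, whose last summand is in \<M>. The hypothesis on
    \<open>a * z / s\<close> makes \<open>\<kappa> j\<close> integral.\<close>
  define \<kappa> where "\<kappa> = (\<lambda>j. t j * (a * z / s))"
  have \<kappa>: "\<kappa> j \<in> K" "\<kappa> j \<in> \<O>" for j
    unfolding \<kappa>_def by (intro K_mult[OF t(1) K_divide[OF K_mult]] as z_K O_mult[OF t(2)])+
  have \<beta>\<kappa>: "\<beta>' j - \<beta> - \<kappa> j \<in> \<M>" for j
  proof -
    have "\<alpha> = s * \<beta> + a" using \<beta>(1) as(3) by simp
    then have "\<beta>' j - \<beta> - \<kappa> j = z * (t j * \<beta>)"
      using as(3) by (simp add: \<beta>'_def \<kappa>_def t(3) field_simps)
    then show ?thesis using t \<beta>(2) by (simp add: M_mult[OF z_M] O_mult)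
  qed
  have \<beta>'O: "\<beta>' j \<in> \<O>" for j
    using O_add[OF O_add[OF M_sub_O[OF \<beta>\<kappa>[of j]] \<beta>(2)] \<kappa>(2)[of j]] by simp
  \<comment> \<open>A monic polynomial of degree p with root \<beta>; its coefficients lie in K
    because s^p G(X) = (a + s X)^p - h.\<close>
  define G where "G = (\<Prod>j<p. [:- \<beta>' j, 1:])"
  have GO: "poly_in \<O> G" unfolding G_def using \<beta>'O by (intro poly_in_O_prod_linear)
  have "smult (s ^ p) G = [:a, s:] ^ p - [:h:]"
  proof (rule poly_eq_poly_eq_iff[THEN iffD1], rule ext)
    fix x
    have "s ^ p * (\<Prod>j<p. x - \<beta>' j) = (\<Prod>j<p. s * (x - \<beta>' j))"
      by (simp add: prod.distrib)
    also have "\<dots> = (\<Prod>j<p. (a + s * x) - \<zeta> ^ j * \<alpha>)"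
      using as(3) by (intro prod.cong) (auto simp: \<beta>'_def field_simps)
    also have "\<dots> = (a + s * x) ^ p - h"
      by (simp only: diff_power_p_factor[symmetric] \<alpha>)
    finally show "poly (smult (s ^ p) G) x = poly ([:a, s:] ^ p - [:h:]) x"
      by (simp add: G_def poly_prod mult.commute)
  qed
  moreover have "poly_in K [:a, s:]" using as by (auto simp: poly_in_def coeff_pCons split: nat.split)
  then have "poly_in K ([:a, s:] ^ p - [:h:])"
    using poly_in_K_power[of "[:a, s:]" p] \<alpha>(2)
    by (auto simp: poly_in_def coeff_pCons intro!: K_diff split: nat.split)
  ultimately have sG: "coeff (smult (s ^ p) G) i \<in> K" for i
    unfolding poly_in_def by simp
  have GK: "coeff G i \<in> K" for i
    using K_divide[OF sG[of i] K_power[OF as(2)], of p] as(3) by simp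
  have GR: "poly_in ?R G" using GO GK by (auto simp: poly_in_def)
  have Gdeg: "degree G = p" "lead_coeff G = 1"
    using monic_prod_linear[of "{..<p}" \<beta>'] by (auto simp: G_def)
  have "\<beta>' 0 = \<beta>" by (simp add: \<beta>'_def \<beta>(1))
  then have G\<beta>: "poly G \<beta> = 0" using p_pos by (auto simp: G_def poly_prod)
  \<comment> \<open>The remainder vanishes at \<beta> modulo \<M> and has degree below d, so by
    minimality it is zero modulo \<M>: \<open>f1\<close> divides \<open>G\<close> there.\<close>
  obtain q r where qr: "poly_in ?R q" "poly_in ?R r" "G = q * f1 + r" "\<forall>i\<ge>degree f1. coeff r i = 0"
    using monic_division[of ?R f1 G] f1 GR by (auto simp: K_closed O_add O_mult O_minus)
  have "poly r \<beta> = - (poly q \<beta> * poly f1 \<beta>)"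
    using G\<beta> unfolding qr(3) by (simp add: eq_neg_iff_add_eq_0 add.commute)
  also have "\<dots> \<in> \<M>" using f1(2) poly_O[OF RO[OF qr(1)] \<beta>(2)] by (simp add: M_minus M_mult')
  finally have rM: "poly_in \<M> r" using small qr f1(3) by simp
  have "lead_coeff q = 1"
  proof -
    have "coeff r p = 0" using qr(4) f1(3) \<open>d < p\<close> by simp
    have qf: "q * f1 = G - r" using qr(3) by simp
    have "degree r \<le> p" using qr(4) f1(3) \<open>d < p\<close> by (intro degree_le) auto
    then have "degree (G - r) \<le> p" using Gdeg by (simp add: degree_diff_le)
    moreover have "coeff (G - r) p = 1" using Gdeg \<open>coeff r p = 0\<close> by simp
    ultimately have "degree (G - r) = p" by (metis le_antisym le_degree zero_neq_one)
    then have "lead_coeff (q * f1) = 1" using \<open>coeff (G - r) p = 1\<close> by (simp add: qf)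
    then show ?thesis using f1(4) by (simp add: lead_coeff_mult)
  qed
  moreover have "f1 * q - (\<Prod>j<p. [:- \<beta>' j, 1:]) = 0 - r"
    using qr(3) by (simp add: G_def[symmetric] mult.commute)
  then have "poly_in \<M> (f1 * q - (\<Prod>j<p. [:- \<beta>' j, 1:]))"
    using poly_in_M_diff[OF _ rM, of 0] by (simp add: poly_in_def)
  ultimately obtain S where S: "S \<subseteq> {..<p}" "card S = d" "poly_in \<M> (f1 - (\<Prod>j\<in>S. [:- \<beta>' j, 1:]))"
    using monic_factor_of_linear_product[of "{..<p}" \<beta>' f1 q] \<beta>'O RO f1 qr(1) by auto
  obtain n where n: "d = Suc n" using \<open>d \<noteq> 0\<close> by (cases d) auto
  have "finite S" using S(1) by (rule finite_subset) simp
  then have "coeff (f1 - (\<Prod>j\<in>S. [:- \<beta>' j, 1:])) n = coeff f1 n + (\<Sum>j\<in>S. \<beta>' j)"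
    using coeff_prod_linear[of S n \<beta>'] S(2) n by simp
  then have 1: "coeff f1 n + (\<Sum>j\<in>S. \<beta>' j) \<in> \<M>" using S(3) by (metis poly_in_def)
  have 2: "(\<Sum>j\<in>S. \<beta>' j - \<beta> - \<kappa> j) \<in> \<M>" using \<beta>\<kappa> by (intro M_sum)
  define e where "e = coeff f1 n + (\<Sum>j\<in>S. \<kappa> j)"
  have e: "e \<in> K" "e \<in> \<O>"
    using f1(1) \<kappa> by (auto simp: e_def poly_in_def intro!: K_add O_add K_sum O_sum)
  have dU: "of_nat d \<in> \<U>" using of_nat_U \<open>d \<noteq> 0\<close> \<open>d < p\<close> by simp
  have "e + of_nat d * \<beta> = (coeff f1 n + (\<Sum>j\<in>S. \<beta>' j)) - (\<Sum>j\<in>S. \<beta>' j - \<beta> - \<kappa> j)"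
    by (simp add: e_def sum_subtractf S(2))
  also have "\<dots> \<in> \<M>" using 1 2 by (rule M_diff)
  finally have "(e + of_nat d * \<beta>) * inverse (of_nat d) \<in> \<M>"
    using dU by (intro M_mult U_O U_inverse)
  moreover have "(e + of_nat d * \<beta>) * inverse (of_nat d) = \<beta> - (- e * inverse (of_nat d))"
    using U_not_0[OF dU] by (simp add: field_simps)
  ultimately have "\<beta> - (- e * inverse (of_nat d)) \<in> \<M>" by simp
  moreover have "- e * inverse (of_nat d) \<in> K" using e by (auto intro: K_closed)
  moreover have "- e * inverse (of_nat d) \<in> \<O>"
    using e U_O[OF U_inverse[OF dU]] by (intro O_mult) (auto simp: O_minus)
  ultimately show False using nres by blast
qed

text \<open>Covers (ii) with a = 0 and s = 1, (iv) with a = 1 and the given s, and (v) with a = 1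
  and s = z. In (ii) and (iv) the conjugates of \<beta> are all congruent, the inseparable case; in
  (v) they stay distinct modulo \<M>.\<close>

lemma defectless_of_residue:
  assumes \<alpha>: "\<alpha> ^ p = h" "h \<in> K" and as: "a \<in> K" "s \<in> K" "s \<noteq> 0" "a * z / s \<in> \<O>"
    and \<beta>: "\<beta> = (\<alpha> - a) / s" "\<beta> \<in> \<O>" and nres: "\<And>b. b \<in> K \<Longrightarrow> b \<in> \<O> \<Longrightarrow> \<beta> - b \<notin> \<M>"
  shows "defectless w K"
proof -
  have indep: "c j \<in> \<M>"
    if c: "\<And>i. i < p \<Longrightarrow> c i \<in> K" "\<And>i. i < p \<Longrightarrow> c i \<in> \<O>" and M: "(\<Sum>i<p. c i * \<beta> ^ i) \<in> \<M>" and j: "j < p"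
    for c j
  proof -
    define f where "f = (\<Sum>i<p. monom (c i) i)"
    have co: "coeff f i = (if i < p then c i else 0)" for i
      by (simp add: f_def coeff_sum)
    have "poly_in (K \<inter> \<O>) f" using c by (auto simp: poly_in_def co)
    moreover have "poly f \<beta> \<in> \<M>" using M by (simp add: f_def poly_sum poly_monom)
    moreover have "degree f < p"
    proof -
      have "degree f \<le> p - 1" using p_pos by (intro degree_le) (auto simp: co)
      then show ?thesis using p_pos by simp
    qed
    ultimately have "poly_in \<M> f" using power_basis_residues[OF assms] by blast
    then have "coeff f j \<in> \<M>" by (simp add: poly_in_def)
    then show ?thesis using j by (simp add: co)
  qed
  \<comment> \<open>\<open>res_indep\<close> concerns sets, so the powers must be known to be
    distinct; equal ones would give a relation with coefficients 1 and -1.\<close>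
  have inj: "inj_on (\<lambda>i. \<beta> ^ i) {..<p}"
  proof (rule linorder_inj_onI')
    fix i j assume ij: "i \<in> {..<p}" "j \<in> {..<p}" "i < j"
    show "\<beta> ^ i \<noteq> \<beta> ^ j"
    proof
      assume eq: "\<beta> ^ i = \<beta> ^ j"
      define c where "c = (\<lambda>k. if k = i then 1 else if k = j then - 1 else 0 :: 'a)"
      have "(\<Sum>k<p. c k * \<beta> ^ k) = (\<Sum>k\<in>{i, j}. c k * \<beta> ^ k)"
        using ij by (intro sum.mono_neutral_right) (auto simp: c_def)
      also have "\<dots> = 0" using ij eq by (simp add: c_def)
      finally have "c i \<in> \<M>"
        using ij by (intro indep[of c i]) (auto simp: c_def K_minus O_minus)
      then show False by (simp add: c_def)
    qed
  qed
  let ?F = "(\<lambda>i. \<beta> ^ i) ` {..<p}"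
  have "res_indep w K ?F"
    unfolding res_indep_def
  proof (intro conjI allI impI ballI)
    show "?F \<subseteq> \<O>" using \<beta>(2) by (auto intro: O_power)
    fix c b assume c: "(\<forall>b\<in>?F. c b \<in> val_ring w K) \<and> (\<Sum>b\<in>?F. c b * b) \<in> \<M>" and b: "b \<in> ?F"
    then obtain j where j: "j < p" "b = \<beta> ^ j" by auto
    have "(\<Sum>i<p. c (\<beta> ^ i) * \<beta> ^ i) \<in> \<M>" using c inj by (simp add: sum.reindex)
    then have "c (\<beta> ^ j) \<in> \<M>"
      using c j by (intro indep[of "\<lambda>i. c (\<beta> ^ i)"]) (auto simp: val_ring_K)
    then show "c b \<in> max_ideal w K" using c b j by (auto simp: max_ideal_K val_ring_K)
  qed
  moreover have "card ?F = p" using inj by (simp add: card_image)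
  ultimately show ?thesis by (intro defectless_of_residues[of ?F]) auto
qed

text \<open>The counterpart of \<open>shift_cases\<close> for the exact root in L: the size of a
  determines b = \<alpha> - 1 to leading order.\<close>

lemma root_cases:
  assumes "\<alpha> ^ p = 1 + a" "a \<in> \<M>" "a \<noteq> 0"
  shows "\<exists>b. b \<noteq> 0 \<and> \<alpha> = 1 + b \<and> (z / b \<in> \<M> \<and> a / b ^ p - 1 \<in> \<M> \<or>
    b / z \<in> \<O> \<and> a / z ^ p - ((b / z) ^ p - b / z) \<in> \<M>)"
proof -
  define b where "b = \<alpha> - 1"
  have \<alpha>: "\<alpha> = 1 + b" by (simp add: b_def)
  have b: "b \<in> \<M>" using power_p_near_1[of \<alpha>] assms by (simp add: b_def)
  have b0: "b \<noteq> 0" using assms by (auto simp: \<alpha>)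
  have a: "a = (1 + b) ^ p - 1" using assms(1) by (simp add: \<alpha>)
  show ?thesis
  proof (cases "z / b \<in> \<M>")
    case True
    then show ?thesis using power_p_small[OF b b0] b0 \<alpha> a by blast
  next
    case False
    then have d: "b / z \<in> \<O>" using not_M[of "z / b"] by simp
    then have "((1 + z * (b / z)) ^ p - 1) / z ^ p - ((b / z) ^ p - b / z) \<in> \<M>" by (rule power_p_large)
    then have "a / z ^ p - ((b / z) ^ p - b / z) \<in> \<M>" using z_not_0 by (simp add: a)
    then show ?thesis using d b0 \<alpha> by blast
  qed
qed

section \<open>From the five forms to a defectless extension\<close>

lemma defectless_i:
  assumes "generates K p h" "prop_i w K p h"
  shows "defectless w K"
proof -
  obtain \<alpha> where \<alpha>: "\<alpha> ^ p = h" using assms by (auto simp: generates_def)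
  note h = generates_K[OF assms(1)] generates_not_0[OF assms(1)]
  have ndiv: "h / y ^ p \<notin> \<U>" if "y \<in> K" "y \<noteq> 0" for y
    using assms(2) that not_p_div_val_iff[OF h(2)] by (simp add: prop_i_def)
  show ?thesis
  proof (rule defectless_of_value[of \<alpha> h])
    show "\<alpha> \<noteq> 0" using \<alpha> h(2) p_pos by (auto simp: zero_power)
    show "\<alpha> / k \<notin> \<U>" if "k \<in> K" "k \<noteq> 0" for k
      using ndiv[OF that] U_power[of "\<alpha> / k" p] by (auto simp: power_divide \<alpha>)
    show "\<alpha> ^ p / h \<in> \<U>" using h \<alpha> by simp
  qed (rule h(1))
qed

lemma defectless_ii:
  assumes "generates K p h" "prop_ii w K p h"
  shows "defectless w K"
proof -
  obtain \<alpha> where \<alpha>: "\<alpha> ^ p = h" using assms by (auto simp: generates_def)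
  have h: "h \<in> K" "h \<in> \<U>" "res_not_pth_power w K p h"
    using assms(2) by (auto simp: prop_ii_def val_units_K)
  then have \<alpha>O: "\<alpha> \<in> \<O>" using U_power_iff[OF p_pos, of \<alpha>] \<alpha> U_O by blast
  show ?thesis
  proof (rule defectless_of_residue[OF \<alpha> h(1), of 0 1 \<alpha>])
    show "\<alpha> - b \<notin> \<M>" if b: "b \<in> K" "b \<in> \<O>" for b
      using power_p_cong[OF \<alpha>O b(2)] not_pth_powerD[OF h(3,1) b] \<alpha> by auto
  qed (use \<alpha>O in auto)
qed

text \<open>In the first alternative of \<open>root_cases\<close>, \<open>b ^ p\<close> has the
  value of t, so b cannot have a value from K. The second would put t at or beyond the
  threshold.\<close>

lemma defectless_iii:
  assumes "generates K p h" "prop_iii w K p z h"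
  shows "defectless w K"
proof -
  obtain \<alpha> where \<alpha>: "\<alpha> ^ p = h" using assms by (auto simp: generates_def)
  obtain c t where ct: "c \<in> K" "c \<in> \<U>" "t \<in> K" "t \<in> \<M>" "t \<noteq> 0" "h = 1 + c * t" "w t < w (z ^ p)"
    "not_p_div_val w K p t"
    using assms(2) by (auto simp: prop_iii_def val_units_K max_ideal_K)
  note c0 = U_not_0[OF ct(2)]
  have ndiv: "t / y ^ p \<notin> \<U>" if "y \<in> K" "y \<noteq> 0" for y
    using ct(8) that not_p_div_val_iff[OF ct(5)] by simp
  have "c * t \<in> \<M>" "c * t \<noteq> 0" using ct U_O c0 M_mult' by auto
  then obtain b where b: "b \<noteq> 0" and cases: "z / b \<in> \<M> \<and> c * t / b ^ p - 1 \<in> \<M> \<or>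
    b / z \<in> \<O> \<and> c * t / z ^ p - ((b / z) ^ p - b / z) \<in> \<M>"
    using root_cases[of \<alpha> "c * t"] \<alpha> ct(6) by blast
  from cases show ?thesis
  proof (elim disjE conjE)
    assume "c * t / b ^ p - 1 \<in> \<M>"
    then have X: "c * t / b ^ p \<in> \<U>" using U_cong[of 1] by simp
    show ?thesis
    proof (rule defectless_of_value[of b t])
      fix k assume k: "k \<in> K" "k \<noteq> 0"
      show "b / k \<notin> \<U>"
      proof
        assume "b / k \<in> \<U>"
        then have "(b / k) ^ p * (c * t / b ^ p / c) \<in> \<U>" by (intro U_mult[OF U_power U_divide[OF X ct(2)]])
        moreover have "(b / k) ^ p * (c * t / b ^ p / c) = t / k ^ p"
          using b c0 by (simp add: power_divide)
        ultimately show False using ndiv[OF k] by simp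
      qed
    next
      have "c / (c * t / b ^ p) \<in> \<U>" by (rule U_divide[OF ct(2) X])
      then show "b ^ p / t \<in> \<U>" using c0 by simp
    qed (use b ct in auto)
  next
    assume d: "b / z \<in> \<O>" and M: "c * t / z ^ p - ((b / z) ^ p - b / z) \<in> \<M>"
    have "(b / z) ^ p - b / z \<in> \<O>" using d by (intro O_diff O_power)
    then have "c * t / z ^ p \<in> \<O>"
      using O_add[OF M_sub_O[OF M], of "(b / z) ^ p - b / z"] by simp
    then have "c * t / z ^ p * inverse c \<in> \<O>" by (rule O_mult[OF _ U_O[OF U_inverse[OF ct(2)]]])
    then have "t / z ^ p \<in> \<O>" using c0 by (simp add: field_simps)
    moreover have "inverse (t / z ^ p) \<in> \<M>" using ct(5,7) z_not_0 by (simp add: w_less_iff)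
    ultimately show ?thesis using inverse_O[of "t / z ^ p"] ct(5) z_not_0 by simp
  qed
qed

text \<open>Below the threshold \<open>\<beta> = b / s\<close> is integral and
  \<open>\<beta> ^ p\<close> is congruent to u, so an element of K congruent to \<beta> would make u
  a p-th power modulo \<M>.\<close>

lemma defectless_iv:
  assumes "generates K p h" "prop_iv w K p z h"
  shows "defectless w K"
proof -
  obtain \<alpha> where \<alpha>: "\<alpha> ^ p = h" using assms by (auto simp: generates_def)
  obtain u s where us: "u \<in> K" "u \<in> \<U>" "s \<in> K" "s \<in> \<M>" "s \<noteq> 0" "h = 1 + u * s ^ p" "w s < w z"
    "res_not_pth_power w K p u"
    using assms(2) by (auto simp: prop_iv_def val_units_K max_ideal_K)
  note u0 = U_not_0[OF us(2)]
  have zs: "z / s \<in> \<M>" using us z_not_0 by (simp add: w_less_iff)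
  have "u * s ^ p \<in> \<M>" "u * s ^ p \<noteq> 0" using us U_O u0 M_mult' M_power p_pos by auto
  then obtain b where b: "b \<noteq> 0" "\<alpha> = 1 + b" and cases: "z / b \<in> \<M> \<and> u * s ^ p / b ^ p - 1 \<in> \<M> \<or>
    b / z \<in> \<O> \<and> u * s ^ p / z ^ p - ((b / z) ^ p - b / z) \<in> \<M>"
    using root_cases[of \<alpha> "u * s ^ p"] \<alpha> us(6) by blast
  from cases show ?thesis
  proof (elim disjE conjE)
    assume XM: "u * s ^ p / b ^ p - 1 \<in> \<M>"
    define X where "X = u * s ^ p / b ^ p"
    have X: "X \<in> \<U>" "X - 1 \<in> \<M>" using U_cong[of 1] XM by (simp_all add: X_def)
    define \<beta> where "\<beta> = b / s"
    have \<beta>p: "\<beta> ^ p = u / X" using b us u0 by (simp add: \<beta>_def X_def power_divide)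
    then have "\<beta> ^ p \<in> \<U>" using us X by (simp add: U_divide)
    then have \<beta>O: "\<beta> \<in> \<O>" using U_power_iff[OF p_pos] U_O by blast
    have "u - \<beta> ^ p = (X - 1) * (u / X)" using U_not_0[OF X(1)] by (simp add: \<beta>p field_simps)
    also have "\<dots> \<in> \<M>" using X us by (intro M_mult U_O U_divide)
    finally have \<beta>u: "u - \<beta> ^ p \<in> \<M>" .
    show ?thesis
    proof (rule defectless_of_residue[OF \<alpha>, of 1 s \<beta>])
      show "h \<in> K" using generates_K assms by blast
      show "\<beta> = (\<alpha> - 1) / s" by (simp add: \<beta>_def b)
      show "\<beta> - y \<notin> \<M>" if y: "y \<in> K" "y \<in> \<O>" for y
        using M_add[OF \<beta>u power_p_cong[OF \<beta>O y(2)]] not_pth_powerD[OF us(8,1) y] by auto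
    qed (use us zs \<beta>O M_sub_O in auto)
  next
    assume d: "b / z \<in> \<O>" and M: "u * s ^ p / z ^ p - ((b / z) ^ p - b / z) \<in> \<M>"
    have "(b / z) ^ p - b / z \<in> \<O>" using d by (intro O_diff O_power)
    then have "u * s ^ p / z ^ p \<in> \<O>"
      using O_add[OF M_sub_O[OF M], of "(b / z) ^ p - b / z"] by simp
    then have "u * s ^ p / z ^ p * inverse u \<in> \<O>" by (rule O_mult[OF _ U_O[OF U_inverse[OF us(2)]]])
    then have "(s / z) ^ p \<in> \<O>" using u0 by (simp add: field_simps)
    then have "s / z \<in> \<O>" using O_power_iff p_pos by blast
    then show ?thesis using inverse_O[of "s / z"] zs us(5) z_not_0 by simp
  qed
qed

text \<open>Here \<open>\<beta> = b / z\<close> is integral and solves X^p - X = c modulo \<M>; an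
  element of K congruent to \<beta> would solve it too.\<close>

lemma defectless_v:
  assumes "generates K p h" "prop_v w K p z h"
  shows "defectless w K"
proof -
  obtain \<alpha> where \<alpha>: "\<alpha> ^ p = h" using assms by (auto simp: generates_def)
  obtain c where c: "c \<in> K" "c \<in> \<U>" "h = 1 + c * z ^ p" "res_not_AS w K p c"
    using assms(2) by (auto simp: prop_v_def val_units_K)
  note c0 = U_not_0[OF c(2)]
  have "c * z ^ p \<in> \<M>" "c * z ^ p \<noteq> 0" using c U_O c0 M_mult' M_power p_pos z_M z_not_0 by auto
  then obtain b where b: "b \<noteq> 0" "\<alpha> = 1 + b" and cases: "z / b \<in> \<M> \<and> c * z ^ p / b ^ p - 1 \<in> \<M> \<or>
    b / z \<in> \<O> \<and> c * z ^ p / z ^ p - ((b / z) ^ p - b / z) \<in> \<M>"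
    using root_cases[of \<alpha> "c * z ^ p"] \<alpha> c(3) by blast
  from cases show ?thesis
  proof (elim disjE conjE)
    assume zb: "z / b \<in> \<M>" and XM: "c * z ^ p / b ^ p - 1 \<in> \<M>"
    have "c * z ^ p / b ^ p / c \<in> \<U>" using U_cong[OF U_1 XM] c(2) by (rule U_divide)
    then have "(z / b) ^ p \<in> \<U>" using c0 by (simp add: power_divide)
    then show ?thesis using zb U_power_iff[OF p_pos] U_not_M by blast
  next
    assume d: "b / z \<in> \<O>" and M: "c * z ^ p / z ^ p - ((b / z) ^ p - b / z) \<in> \<M>"
    define \<beta> where "\<beta> = b / z"
    have \<beta>: "\<beta> \<in> \<O>" "c - (\<beta> ^ p - \<beta>) \<in> \<M>" using d M z_not_0 by (simp_all add: \<beta>_def)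
    show ?thesis
    proof (rule defectless_of_residue[OF \<alpha>, of 1 z \<beta>])
      show "h \<in> K" using generates_K assms by blast
      show "\<beta> = (\<alpha> - 1) / z" by (simp add: \<beta>_def b)
      fix y assume y: "y \<in> K" "y \<in> \<O>"
      show "\<beta> - y \<notin> \<M>"
      proof
        assume y\<beta>: "\<beta> - y \<in> \<M>"
        have "c - (y ^ p - y) = c - (\<beta> ^ p - \<beta>) + (\<beta> ^ p - y ^ p) - (\<beta> - y)" by simp
        also have "\<dots> \<in> \<M>"
          using \<beta>(2) power_p_cong[OF \<beta>(1) y(2) y\<beta>] y\<beta> by (intro M_diff[OF M_add])
        finally show False using not_ASD[OF c(4,1) y] by blast
      qed
    qed (use \<beta> z_K z_not_0 in auto)
  qed
qed

lemma normal_form_imp_defectless: "generates K p h \<Longrightarrow> normal_form h \<Longrightarrow> defectless w K"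
  using defectless_i defectless_ii defectless_iii defectless_iv defectless_v by (auto simp: normal_form_def)

section \<open>Mutual exclusion of the five forms\<close>

lemma near_1_exclusive:
  assumes "a \<in> \<M>" "a \<in> K"
  shows "\<not> prop_i w K p (1 + a)" "\<not> prop_ii w K p (1 + a)"
proof -
  have "1 + a \<in> \<U>" using U_cong[of 1 "1 + a"] assms by simp
  then have "w (1 + a) = w (1 ^ p)" by (simp add: U_iff)
  then show "\<not> prop_i w K p (1 + a)"
    by (auto simp: prop_i_def not_p_div_val_def intro!: bexI[of _ 1])
  show "\<not> prop_ii w K p (1 + a)"
    using not_pth_powerD[of "1 + a" 1] assms by (auto simp: prop_ii_def val_units_K)
qed

text \<open>Forms (iii)-(v) are one-units, which rules out (i) and (ii). Among them
  \<open>w (h - 1)\<close> decides: it equals \<open>w (z ^ p)\<close> for (v) and is smaller for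
  the others, and it is the value of a p-th power from K for (iv) but not for (iii).\<close>

lemma props_exclusive:
  "prop_ii w K p h \<Longrightarrow> \<not> prop_i w K p h"
  "prop_iii w K p z h \<Longrightarrow> \<not> prop_i w K p h \<and> \<not> prop_ii w K p h"
  "prop_iv w K p z h \<Longrightarrow> \<not> prop_i w K p h \<and> \<not> prop_ii w K p h \<and> \<not> prop_iii w K p z h"
  "prop_v w K p z h \<Longrightarrow> \<not> prop_i w K p h \<and> \<not> prop_ii w K p h \<and> \<not> prop_iii w K p z h \<and>
     \<not> prop_iv w K p z h"
proof -
  have iii: "h - 1 \<noteq> 0 \<and> w (h - 1) < w (z ^ p) \<and> not_p_div_val w K p (h - 1) \<and> h - 1 \<in> \<M> \<and> h - 1 \<in> K"
    if P: "prop_iii w K p z h"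
  proof -
    obtain c t where ct: "c \<in> K" "c \<in> \<U>" "t \<in> K" "t \<in> \<M>" "t \<noteq> 0" "h = 1 + c * t" "w t < w (z ^ p)"
      "not_p_div_val w K p t"
      using P by (auto simp: prop_iii_def val_units_K max_ideal_K)
    moreover from this have "w (c * t) = w t" by (simp add: w_mult U_iff)
    ultimately show ?thesis using M_mult'[OF U_O] U_not_0[of c]
      by (auto simp: not_p_div_val_def intro: K_mult)
  qed
  have iv: "w (h - 1) < w (z ^ p) \<and> \<not> not_p_div_val w K p (h - 1) \<and> h - 1 \<in> \<M> \<and> h - 1 \<in> K"
    if P: "prop_iv w K p z h"
  proof -
    obtain u s where us: "u \<in> K" "u \<in> \<U>" "s \<in> K" "s \<in> \<M>" "s \<noteq> 0" "h = 1 + u * s ^ p" "w s < w z"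
      using P by (auto simp: prop_iv_def val_units_K max_ideal_K)
    then have eq: "w (h - 1) = w (s ^ p)" by (simp add: w_mult U_iff)
    have "(z / s) ^ p \<in> \<M>" using us z_not_0 p_pos by (intro M_power) (simp_all add: w_less_iff)
    then have "w (s ^ p) < w (z ^ p)" using us z_not_0 by (simp add: w_less_iff power_divide)
    moreover have "\<not> not_p_div_val w K p (h - 1)" using us eq by (auto simp: not_p_div_val_def)
    moreover have "h - 1 \<in> \<M>" using us p_pos by (auto intro: M_mult' M_power U_O)
    ultimately show ?thesis using eq us by (auto intro: K_closed)
  qed
  have v: "w (h - 1) = w (z ^ p) \<and> h - 1 \<in> \<M> \<and> h - 1 \<in> K" if P: "prop_v w K p z h"
  proof -
    obtain c where c: "c \<in> K" "c \<in> \<U>" "h = 1 + c * z ^ p"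
      using P by (auto simp: prop_v_def val_units_K)
    then show ?thesis using z_not_0 z_K z_M p_pos
      by (auto simp: w_mult U_iff intro!: K_closed M_mult' M_power U_O)
  qed
  note ex = near_1_exclusive[of "h - 1"]
  show "prop_ii w K p h \<Longrightarrow> \<not> prop_i w K p h"
    by (auto simp: prop_i_def prop_ii_def not_p_div_val_def val_units_K U_iff intro!: bexI[of _ 1])
  show "prop_iii w K p z h \<Longrightarrow> \<not> prop_i w K p h \<and> \<not> prop_ii w K p h"
    using iii ex by auto
  show "prop_iv w K p z h \<Longrightarrow> \<not> prop_i w K p h \<and> \<not> prop_ii w K p h \<and> \<not> prop_iii w K p z h"
    using iii iv ex by auto
  show "prop_v w K p z h \<Longrightarrow> \<not> prop_i w K p h \<and> \<not> prop_ii w K p h \<and> \<not> prop_iii w K p z h \<and>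
     \<not> prop_iv w K p z h"
    using iii iv v ex by auto
qed

lemma exactly_one_iff_normal_form:
  assumes "h \<in> val_ring w K"
  shows "exactly_one [prop_i w K p h, prop_ii w K p h, prop_iii w K p z h, prop_iv w K p z h, prop_v w K p z h]
    \<longleftrightarrow> normal_form h"
  using assms props_exclusive[of h] unfolding exactly_one_def normal_form_def val_ring_K by auto

end

theorem theorem3p3p3:
  fixes w :: "'a::field_char_0 \<Rightarrow> 'g::linordered_ab_group_add"
    and K :: "'a set" and p :: nat and \<zeta> :: 'a
  assumes prime_p: "prime p"
    and val: "valuation w"
    and subK: "is_subfield K"
    and hens: "henselian w K"
    and not_field: "\<exists>x\<in>K. x \<noteq> 0 \<and> 0 < w x"
    and char_k: "0 < w (of_nat p :: 'a)"
    and zeta: "\<zeta> \<in> K" "\<zeta> ^ p = 1" "\<zeta> \<noteq> 1"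
    and kummer: "\<exists>h. generates K p h"
    and deg: "ext_degree K (UNIV :: 'a set) = p"
  shows "((\<exists>h. best_gen w K p h) \<longleftrightarrow>
           (\<exists>h\<in>val_ring w K. generates K p h \<and>
              exactly_one [prop_i w K p h, prop_ii w K p h, prop_iii w K p (\<zeta> - 1) h,
                           prop_iv w K p (\<zeta> - 1) h, prop_v w K p (\<zeta> - 1) h]))
       \<and> ((\<exists>h. best_gen w K p h) \<longleftrightarrow> defectless w K)"
proof -
  interpret kummer_field w K p \<zeta>
    by unfold_locales (fact prime_p val subK hens char_k zeta deg)+
  have "(\<exists>h\<in>val_ring w K. generates K p h \<and>
      exactly_one [prop_i w K p h, prop_ii w K p h, prop_iii w K p (\<zeta> - 1) h,
                   prop_iv w K p (\<zeta> - 1) h, prop_v w K p (\<zeta> - 1) h]) \<longleftrightarrow>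
    (\<exists>h. generates K p h \<and> normal_form h)"
    unfolding z_def[symmetric] using exactly_one_iff_normal_form generates_K
    by (metis normal_form_def val_ring_K)
  moreover have "(\<exists>h. best_gen w K p h) \<longleftrightarrow> (\<exists>h. generates K p h \<and> normal_form h)"
    using normal_form_imp_best best_imp_normal_form by blast
  moreover have "defectless w K \<longleftrightarrow> (\<exists>h. generates K p h \<and> normal_form h)"
    using normal_form_imp_defectless defectless_imp_normal_form kummer by blast
  ultimately show ?thesis by simp
qed

end
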